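(* Let $D$ and $\Omega$ be domains in $\mathbb{C}^n$, $n\geq 2$, $\Omega$ bounded, and let $F: D \to \Omega$ be a proper holomorphic map. Let $p\in \partial D$ and $q \in C(F,p)$. Assume that there is a continuous, negative plurisubharmonic function $\rho$ on $D$ and a neighbourhood $U$ of $p$ such that $\partial D \cap U$ is a $\mathcal{C}^{1,\,\mathrm{Dini}}$ submanifold of $U$, and $\rho(z) \geq - \delta_D (z)$ for all $z\in U \cap D$. Suppose there exists a neighbourhood $\mathscr{O}$ of $q$ such that (i) $\partial \Omega \cap \mathscr{O}$ is a $\mathcal{C}^2$ submanifold of $\mathscr{O}$, and (ii) $\mathscr{O} \cap \Omega$ is log-type convex. Then there exists a neighbourhood $\mathscr{V}$ of $p$ in $\partial D$ (relative topology) such that $F$ extends to $D \cup \mathscr{V}$ as a continuous map.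
   Context: Notation. $\|\cdot\|$ is the Euclidean norm, $B^n(z,r)$ is the open Euclidean ball in $\mathbb{C}^n$ with centre $z$ and radius $r$, $\mathbb{D}$ is the open unit disc in $\mathbb{C}$. For an open set $G\subsetneq\mathbb{C}^n$ and $z\in G$, $\delta_G(z):=\mathrm{dist}(z,\mathbb{C}^n\setminus G)$. Cluster set. $C(F,p):=\{w\in\mathbb{C}^n:\exists \{z_\nu\}\subset D \text{ with } \lim_{\nu\to\infty} z_\nu=p \text{ and } \lim_{\nu\to\infty}F(z_\nu)=w\}$. Dini condition. A function $\omega:[0,\infty)\to[0,\infty)$ with $\omega(0)=0$ satisfies a Dini condition if $\omega$ is monotone increasing and $\int_0^{\varepsilon} r^{-1}\omega(r)\,dr<\infty$ for some (hence for any) $\varepsilon>0$. $\mathcal{C}^{1,\mathrm{Dini}}$ submanifold. Let $D\subset\mathbb{C}^n$ be a domain, $p\in\partial D$, $U$ a neighbourhood of $p$, and $S:=\partial D\cap U$. $S$ is a $\mathcal{C}^{1,\mathrm{Dini}}$ submanifold of $U$ if there exists a function $\omega:[0,\infty)\to[0,\infty)$, $\omega(0)=0$, satisfying a Dini condition, and for each $\xi\in S$ there exist a neighbourhood $\mathcal{N}_\xi$ of $\xi$, $\mathcal{N}_\xi\subset U$, a unitary map $\mathsf{U}_\xi$, a constant $r_\xi>0$, and a $\mathcal{C}^1$ function $\varphi_\xi:B^{n-1}(0,r_\xi)\times(-r_\xi,r_\xi)\to\mathbb{R}$ (where $B^{n-1}(0,r_\xi)\times(-r_\xi,r_\xi)\subset\mathbb{C}^{n-1}\times\mathbb{R}$)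 such that $\|\nabla\varphi_\xi(x)-\nabla\varphi_\xi(y)\|\le\omega(\|x-y\|)$ for all $x,y$ in the domain of $\varphi_\xi$ and, writing $\mathsf{U}^\xi(z):=\mathsf{U}_\xi(z-\xi)$, $$\mathsf{U}^\xi(\mathcal{N}_\xi\cap D)\subset\{(Z',Z_n)\in\mathbb{C}^{n-1}\times\mathbb{C}:\ \mathrm{Im}(Z_n)>\varphi_\xi(Z',\mathrm{Re}(Z_n)),\ \|Z'\|<r_\xi,\ |\mathrm{Re}(Z_n)|<r_\xi\},$$ $$\mathsf{U}^\xi(\mathcal{N}_\xi\cap\partial D)=\{(Z',Z_n)\in\mathbb{C}^{n-1}\times\mathbb{C}:\ \mathrm{Im}(Z_n)=\varphi_\xi(Z',\mathrm{Re}(Z_n)),\ \|Z'\|<r_\xi,\ |\mathrm{Re}(Z_n)|<r_\xi\}.$$ Log-type convexity. For a bounded convex domain $G\subset\mathbb{C}^n$, $z\in G$ and $v\in\mathbb{C}^n\setminus\{0\}$, let $\delta_G(z;v):=\sup\{r>0: z+(r\mathbb{D})\frac{v}{\|v\|}\subset G\}$. A bounded convex domain $G\subset\mathbb{C}^n$, $n\ge2$, is log-type convex if there are constants $C,\nu>0$ such that $\delta_G(z;v)\le C/|\log\delta_G(z)|^{1+\nu}$ for all $z\in G$ and all $v\in\mathbb{C}^n\setminus\{0\}$. *)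

theory Defs
  imports "HOL-Analysis.Analysis"
begin

text \<open>
  The space \<open>\<complex>\<^sup>n\<close> is \<^typ>\<open>complex ^ 'n\<close> with \<open>n = CARD('n)\<close>; its library norm is the Euclidean one.
  For open \<open>G \<noteq> \<complex>\<^sup>n\<close> the boundary distance \<open>\<delta>\<^sub>G(z)\<close> is \<^term>\<open>infdist z (- G)\<close>.
  Neighbourhoods of points are taken to be open throughout.
\<close>

text \<open>Complex Frechet differentiability: the derivative is given by a complex matrix.\<close>

definition holomorphic_map_on :: "(complex ^ 'n \<Rightarrow> complex ^ 'm) \<Rightarrow> (complex ^ 'n) set \<Rightarrow> bool" where
  "holomorphic_map_on F D \<longleftrightarrow>
     (\<forall>z\<in>D. \<exists>A :: complex ^ 'n ^ 'm. (F has_derivative (\<lambda>h. A *v h)) (at z))"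

text \<open>
  Proper maps are rendered by the library's \<^const>\<open>proper_map\<close> (closed, with compact fibres). In the
  present setting this says that preimages of compact sets are compact.
\<close>

lemma proper_map_iff_compact_preimage:
  fixes F :: "complex ^ 'n \<Rightarrow> complex ^ 'm"
  assumes "continuous_on D F" "F ` D \<subseteq> \<Omega>" "open \<Omega>"
  shows "proper_map (top_of_set D) (top_of_set \<Omega>) F \<longleftrightarrow>
           (\<forall>K. compact K \<and> K \<subseteq> \<Omega> \<longrightarrow> compact {z \<in> D. F z \<in> K})"
proof
  assume p: "proper_map (top_of_set D) (top_of_set \<Omega>) F"
  show "\<forall>K. compact K \<and> K \<subseteq> \<Omega> \<longrightarrow> compact {z \<in> D. F z \<in> K}"
  proof (intro allI impI)
    fix K assume "compact K \<and> K \<subseteq> \<Omega>"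
    then have "compactin (top_of_set \<Omega>) K"
      by (simp add: compactin_subtopology)
    from compactin_proper_map_preimage[OF p this] show "compact {z \<in> D. F z \<in> K}"
      by (simp add: compactin_subtopology)
  qed
next
  assume c: "\<forall>K. compact K \<and> K \<subseteq> \<Omega> \<longrightarrow> compact {z \<in> D. F z \<in> K}"
  show "proper_map (top_of_set D) (top_of_set \<Omega>) F"
  proof (rule compact_imp_proper_map)
    show "k_space (top_of_set \<Omega>)"
      using assms(3) by (intro locally_compact_imp_k_space)
        (auto simp: locally_compact_space_euclidean intro: locally_compact_space_open_subset)
    show "kc_space (top_of_set \<Omega>)"
      by (intro Hausdorff_imp_kc_space Hausdorff_space_subtopology Hausdorff_space_euclidean)
  qed (use assms c in \<open>auto simp: compactin_subtopology\<close>)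
qed

definition cluster_set :: "(complex ^ 'n \<Rightarrow> complex ^ 'm) \<Rightarrow> (complex ^ 'n) set \<Rightarrow> complex ^ 'n \<Rightarrow> (complex ^ 'm) set" where
  "cluster_set F D p =
     {w. \<exists>z :: nat \<Rightarrow> complex ^ 'n. (\<forall>\<nu>. z \<nu> \<in> D) \<and> z \<longlonglongrightarrow> p \<and> (\<lambda>\<nu>. F (z \<nu>)) \<longlonglongrightarrow> w}"

text \<open>
  For a continuous function, plurisubharmonicity on an open set is the sub-mean value inequality
  on every closed analytic disc \<open>{z + \<zeta> v : |\<zeta>| \<le> 1}\<close> (\<open>v\<close> of arbitrary length) contained in the set.
\<close>

definition continuous_plurisubharmonic_on :: "(complex ^ 'n) set \<Rightarrow> (complex ^ 'n \<Rightarrow> real) \<Rightarrow> bool" where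
  "continuous_plurisubharmonic_on D u \<longleftrightarrow>
     continuous_on D u \<and>
     (\<forall>z v. (\<forall>\<zeta>\<in>cball 0 1. z + \<zeta> *s v \<in> D) \<longrightarrow>
        u z \<le> (1 / (2 * pi)) * integral {0..2 * pi} (\<lambda>\<theta>. u (z + cis \<theta> *s v)))"

definition dini_function :: "(real \<Rightarrow> real) \<Rightarrow> bool" where
  "dini_function \<omega> \<longleftrightarrow>
     (\<forall>r\<ge>0. 0 \<le> \<omega> r) \<and> \<omega> 0 = 0 \<and> mono_on {0..} \<omega> \<and>
     (\<exists>\<epsilon>>0. (\<integral>\<^sup>+ r\<in>{0<..<\<epsilon>}. ennreal (\<omega> r / r) \<partial>lborel) < \<infinity>)"

definition unitary_map :: "(complex ^ 'n \<Rightarrow> complex ^ 'n) \<Rightarrow> bool" where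
  "unitary_map T \<longleftrightarrow>
     (\<exists>A :: complex ^ 'n ^ 'n. (\<chi> i j. cnj (A $ j $ i)) ** A = mat 1 \<and> T = (\<lambda>z. A *v z))"

text \<open>
  A coordinate index \<open>k\<close> plays the role of the last coordinate \<open>Z\<^sub>n\<close>. The factor \<open>\<complex>\<^sup>n\<^sup>-\<^sup>1\<close> is realised
  as the hyperplane \<open>{w. w $ k = 0}\<close> of \<open>\<complex>\<^sup>n\<close>, and \<^term>\<open>first_coords k Z\<close> is \<open>Z'\<close>.
\<close>

definition first_coords :: "'n::finite \<Rightarrow> complex ^ 'n \<Rightarrow> complex ^ 'n" where
  "first_coords k Z = (\<chi> i. if i = k then 0 else Z $ i)"

definition graph_domain :: "'n::finite \<Rightarrow> real \<Rightarrow> ((complex ^ 'n) \<times> real) set" where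
  "graph_domain k r = {(w, t). w $ k = 0 \<and> norm w < r \<and> \<bar>t\<bar> < r}"

text \<open>
  \<^term>\<open>has_gradient_on k r \<phi> g\<close>: \<open>g\<close> is the gradient of \<open>\<phi>\<close> on \<open>B\<^sup>n\<^sup>-\<^sup>1(0,r) \<times> (-r,r)\<close> with respect to the
  real inner product. The derivative within \<^const>\<open>graph_domain\<close> determines \<open>g\<close> only up to its
  \<open>k\<close>-th component, which is therefore required to vanish.
\<close>

definition has_gradient_on ::
  "'n::finite \<Rightarrow> real \<Rightarrow> ((complex ^ 'n) \<times> real \<Rightarrow> real) \<Rightarrow> ((complex ^ 'n) \<times> real \<Rightarrow> (complex ^ 'n) \<times> real) \<Rightarrow> bool" where
  "has_gradient_on k r \<phi> g \<longleftrightarrow>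
     (\<forall>x\<in>graph_domain k r.
        fst (g x) $ k = 0 \<and> (\<phi> has_derivative (\<lambda>h. g x \<bullet> h)) (at x within graph_domain k r))"

text \<open>
  \<open>\<partial>D \<inter> U\<close> is a \<open>C\<^sup>1\<close>-Dini submanifold of \<open>U\<close>. The choice of \<open>k\<close> is immaterial, since the unitary
  maps \<open>T\<close> may permute the coordinates.
\<close>

definition C1_Dini_boundary :: "(complex ^ 'n) set \<Rightarrow> (complex ^ 'n) set \<Rightarrow> bool" where
  "C1_Dini_boundary D U \<longleftrightarrow>
     (\<exists>\<omega> k. dini_function \<omega> \<and>
       (\<forall>\<xi>\<in>frontier D \<inter> U. \<exists>N T r \<phi> g.
          open N \<and> \<xi> \<in> N \<and> N \<subseteq> U \<and> unitary_map T \<and> r > 0 \<and>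
          has_gradient_on k r \<phi> g \<and> continuous_on (graph_domain k r) g \<and>
          (\<forall>x\<in>graph_domain k r. \<forall>y\<in>graph_domain k r. norm (g x - g y) \<le> \<omega> (norm (x - y))) \<and>
          (\<lambda>z. T (z - \<xi>)) ` (N \<inter> D) \<subseteq>
            {Z. Im (Z $ k) > \<phi> (first_coords k Z, Re (Z $ k)) \<and>
                norm (first_coords k Z) < r \<and> \<bar>Re (Z $ k)\<bar> < r} \<and>
          (\<lambda>z. T (z - \<xi>)) ` (N \<inter> frontier D) =
            {Z. Im (Z $ k) = \<phi> (first_coords k Z, Re (Z $ k)) \<and>
                norm (first_coords k Z) < r \<and> \<bar>Re (Z $ k)\<bar> < r}))"

definition C2_on :: "('a::real_normed_vector \<Rightarrow> 'b::real_normed_vector) \<Rightarrow> 'a set \<Rightarrow> bool" where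
  "C2_on f N \<longleftrightarrow>
     (\<exists>f' :: 'a \<Rightarrow> ('a \<Rightarrow>\<^sub>L 'b). \<exists>f'' :: 'a \<Rightarrow> ('a \<Rightarrow>\<^sub>L ('a \<Rightarrow>\<^sub>L 'b)).
        (\<forall>x\<in>N. (f has_derivative blinfun_apply (f' x)) (at x) \<and>
               (f' has_derivative blinfun_apply (f'' x)) (at x)) \<and>
        continuous_on N f'')"

text \<open>
  Embedded \<open>C\<^sup>2\<close> submanifold, by flattening charts: locally a \<open>C\<^sup>2\<close> diffeomorphism \<open>\<Phi>\<close>, with inverse \<open>\<Psi>\<close>,
  maps \<open>S\<close> onto a piece of a real linear subspace of dimension \<open>d\<close>.
\<close>

definition C2_submanifold :: "('a::euclidean_space) set \<Rightarrow> 'a set \<Rightarrow> bool" where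
  "C2_submanifold S U \<longleftrightarrow>
     S \<subseteq> U \<and>
     (\<exists>d. \<forall>\<xi>\<in>S. \<exists>N (\<Phi> :: 'a \<Rightarrow> 'a) \<Psi> L.
        open N \<and> \<xi> \<in> N \<and> N \<subseteq> U \<and> C2_on \<Phi> N \<and>
        open (\<Phi> ` N) \<and> C2_on \<Psi> (\<Phi> ` N) \<and> (\<forall>x\<in>N. \<Psi> (\<Phi> x) = x) \<and>
        subspace L \<and> dim L = d \<and> \<Phi> ` (S \<inter> N) = \<Phi> ` N \<inter> L)"

text \<open>The quantity \<open>\<delta>\<^sub>G(z; v)\<close>, for \<open>v \<noteq> 0\<close>.\<close>

definition directional_dist :: "(complex ^ 'n) set \<Rightarrow> complex ^ 'n \<Rightarrow> complex ^ 'n \<Rightarrow> real" where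
  "directional_dist G z v = Sup {r. r > 0 \<and> (\<forall>\<zeta>\<in>ball 0 r. z + \<zeta> *s (v /\<^sub>R norm v) \<in> G)}"

text \<open>
  Where \<open>\<delta>\<^sub>G(z) = 1\<close> the bound \<open>C / |log \<delta>\<^sub>G(z)|\<^sup>1\<^sup>+\<^sup>\<nu>\<close> is read as \<open>+\<infinity>\<close>, so there is no condition at such
  points (HOL division would give \<open>0\<close> instead).
\<close>

definition log_type_convex :: "(complex ^ 'n) set \<Rightarrow> bool" where
  "log_type_convex G \<longleftrightarrow>
     open G \<and> convex G \<and> bounded G \<and> G \<noteq> {} \<and>
     (\<exists>C>0. \<exists>\<nu>>0. \<forall>z\<in>G. \<forall>v. v \<noteq> 0 \<longrightarrow> infdist z (- G) \<noteq> 1 \<longrightarrow>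
        directional_dist G z v \<le> C / \<bar>ln (infdist z (- G))\<bar> powr (1 + \<nu>))"

end

theory Submission
  imports Defs "HOL-Complex_Analysis.Conformal_Mappings"
begin

text \<open>
  Near \<open>q\<close> the target coincides with the convex set \<open>G = \<O> \<inter> \<Omega>\<close>. A Hopf-type lemma on balls, transported
  through \<open>F\<close> and iterated along a chain of balls shrinking towards the boundary of \<open>G\<close>, gives
  \<open>\<rho> z \<le> - c \<delta>\<^sub>G(F z)\<^sup>k\<close>; together with \<open>\<rho> \<ge> - \<delta>\<^sub>D\<close> this makes \<open>\<bar>log \<delta>\<^sub>G(F z)\<bar>\<close> at least a multiple of
  \<open>\<bar>log \<delta>\<^sub>D(z)\<bar>\<close>, and a power of \<open>\<delta>\<^sub>G\<close> serves as well as a linear bound because only its logarithm matters.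
  A holomorphic map of the unit disc into a convex set, with value \<open>w\<close> at \<open>0\<close>, has a derivative there of size
  at most twice the directional distance at \<open>w\<close>. Applied to \<open>F\<close> on discs of radius comparable to \<open>\<delta>\<^sub>D(z)\<close>, log-type
  convexity yields \<open>\<parallel>F'(z)\<parallel> \<le> K / (\<delta>\<^sub>D(z) \<bar>log \<delta>\<^sub>D(z)\<bar>\<^sup>1\<^sup>+\<^sup>\<nu>)\<close> as long as \<open>F z\<close> stays close to \<open>q\<close>. The bound is
  integrable up to the boundary, so \<open>F\<close> oscillates little near \<open>p\<close>, and in particular never leaves the
  neighbourhood of \<open>q\<close> in which the bound holds.
\<close>

text \<open>Pushing \<rho> forward along the fibres of \<open>F\<close> would require
  plurisubharmonicity across the branch locus. Barriers are therefore pulled back to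
  \<open>D\<close> by \<open>F\<close>, and properness supplies compact preimages on which maxima
  are attained. A general convex \<open>G\<close> has no interior tangent balls of uniform size, so
  Hopf's linear bound is out of reach. Inside the cone spanned by a fixed ball and a point near the
  boundary, however, there are always balls with radii in geometric progression; each link of such a
  chain costs a factor 8, and this produces the exponent \<open>k\<close>. The last step looks
  circular: the derivative bound presupposes that \<open>F z\<close> is near \<open>q\<close>, which
  is what it has to deliver. A sequence realising \<open>q\<close> as a cluster value gives a
  starting point, and a first-exit argument does the rest: 1 / (t |log t|^(1+\<nu>)) has the
  antiderivative |log t|^(-\<nu>) / \<nu>, which tends to 0 with t, so on a small ball the whole
  variation of \<open>F\<close> along a path is below the available margin.\<close>

section \<open>The Hermitian product and projections along a complex line\<close>

lemma norm_vector_smult: "norm (c *s x) = norm c * norm x" for x :: "complex ^ 'n"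
proof -
  have "norm (c *s x) = sqrt (\<Sum>i\<in>UNIV. (norm c)\<^sup>2 * (norm (x $ i))\<^sup>2)"
    by (simp add: norm_vec_def L2_set_def norm_mult power_mult_distrib)
  then show ?thesis
    by (simp add: norm_vec_def L2_set_def real_sqrt_mult flip: sum_distrib_left)
qed

lemma scaleR_eq_vector_smult: "r *\<^sub>R x = complex_of_real r *s x" for x :: "complex ^ 'n"
  by (simp add: vec_eq_iff scaleR_conv_of_real[where 'a=complex])

lemma bounded_linear_vector_smult: "bounded_linear (\<lambda>t. t *s v)" for v :: "complex ^ 'n"
  by (rule bounded_linear_intro[where K = "norm v"])
    (simp_all add: vector_sadd_rdistrib norm_vector_smult scaleR_eq_vector_smult vector_smult_assoc scaleR_conv_of_real[where 'a=complex])

text \<open>Complex-linear in the second argument, so that \<open>herm e (F y - a)\<close> is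
  holomorphic in \<open>y\<close>; the real inner product of the type is only its real part.\<close>

definition herm :: "complex ^ 'n \<Rightarrow> complex ^ 'n \<Rightarrow> complex" where
  "herm e x = (\<Sum>i\<in>UNIV. cnj (e $ i) * x $ i)"

lemma herm_add: "herm e (x + y) = herm e x + herm e y"
  by (simp add: herm_def algebra_simps sum.distrib)

lemma herm_diff: "herm e (x - y) = herm e x - herm e y"
  by (simp add: herm_def algebra_simps sum_subtractf)

lemma herm_smult: "herm e (c *s x) = c * herm e x"
  by (simp add: herm_def algebra_simps sum_distrib_left)

lemma herm_scaleR: "herm e (r *\<^sub>R x) = r *\<^sub>R herm e x"
  by (simp add: scaleR_eq_vector_smult herm_smult scaleR_conv_of_real)

lemma inner_eq_Re_herm: "x \<bullet> y = Re (herm x y)"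
  by (simp add: herm_def inner_vec_def inner_complex_def)

lemma herm_self: "herm x x = of_real ((norm x)\<^sup>2)"
proof -
  have "Im (herm x x) = 0" by (simp add: herm_def)
  moreover have "Re (herm x x) = (norm x)\<^sup>2"
    by (simp add: power2_norm_eq_inner inner_eq_Re_herm)
  ultimately show ?thesis by (simp add: complex_eq_iff)
qed

lemma norm_herm_le: "norm (herm e x) \<le> norm e * norm x"
proof (cases "herm e x = 0")
  case False
  define u where "u = cnj (herm e x) / norm (herm e x)"
  have "u * herm e x = norm (herm e x)"
    using False complex_norm_square[of "herm e x"]
    by (simp add: u_def field_simps power2_eq_square)
  then have "norm (herm e x) = e \<bullet> (u *s x)"
    by (simp add: inner_eq_Re_herm herm_smult)
  also have "\<dots> \<le> norm e * norm (u *s x)" by (rule norm_cauchy_schwarz)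
  also have "norm u = 1" using False by (simp add: u_def norm_divide)
  then have "norm (u *s x) = norm x" by (simp add: norm_vector_smult)
  finally show ?thesis .
qed simp

lemma bounded_linear_herm: "bounded_linear (herm e)"
  by (rule bounded_linear_intro[where K = "norm e"])
    (use norm_herm_le[of e] in \<open>simp_all add: herm_add herm_scaleR mult.commute\<close>)

text \<open>For unit \<open>e\<close>, the projection onto the Hermitian complement of the complex
  line through \<open>e\<close>.\<close>

definition perp :: "complex ^ 'n \<Rightarrow> complex ^ 'n \<Rightarrow> complex ^ 'n" where
  "perp e x = x - herm e x *s e"

lemma perp_add: "perp e (x + y) = perp e x + perp e y"
  by (simp add: perp_def herm_add vector_sadd_rdistrib)

lemma perp_diff: "perp e (x - y) = perp e x - perp e y"
  by (simp add: perp_def herm_diff vec_eq_iff algebra_simps)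

lemma perp_smult: "perp e (c *s x) = c *s perp e x"
  by (simp add: perp_def herm_smult vector_ssub_ldistrib vector_smult_assoc)

lemma norm_decomp:
  assumes "norm e = 1"
  shows "(norm x)\<^sup>2 = (norm (herm e x))\<^sup>2 + (norm (perp e x))\<^sup>2"
proof -
  define h where "h = herm e x"
  have hc: "cnj h * h = complex_of_real ((norm h)\<^sup>2)"
    by (metis complex_norm_square mult.commute)
  have 1: "herm (h *s e) x = cnj h * h"
    by (simp add: h_def herm_def sum_distrib_left mult.assoc)
  have 2: "herm (h *s e) (h *s e) = cnj h * h"
    unfolding herm_self norm_vector_smult hc by (simp add: assms)
  have "(h *s e) \<bullet> x = (norm h)\<^sup>2" "(h *s e) \<bullet> (h *s e) = (norm h)\<^sup>2"
    unfolding inner_eq_Re_herm 1 2 hc by simp_all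
  then have "(norm (x - h *s e))\<^sup>2 = (norm x)\<^sup>2 - (norm h)\<^sup>2"
    unfolding power2_norm_eq_inner by (simp add: inner_diff_left inner_diff_right inner_commute)
  then show ?thesis by (simp add: h_def perp_def)
qed

lemma perp_self: "norm e = 1 \<Longrightarrow> perp e e = 0"
  by (simp add: perp_def herm_self)

lemma perp_norm_le: "norm e = 1 \<Longrightarrow> norm (perp e x) \<le> norm x"
  using norm_decomp[of e x] by (metis norm_ge_zero power2_le_imp_le le_add_same_cancel2 zero_le_power2)

section \<open>Circle means and restrictions to complex lines\<close>

lemma has_integral_circle_mean:
  fixes f :: "complex \<Rightarrow> complex"
  assumes "f holomorphic_on ball 0 R" "R > 1"
  shows "((\<lambda>\<theta>. f (cis \<theta>)) has_integral 2 * pi * f 0) {0..2 * pi}"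
proof -
  have "f holomorphic_on cball 0 1"
    by (rule holomorphic_on_subset[OF assms(1)]) (use assms(2) in auto)
  from Cauchy_integral_circlepath_simple[OF this, of 0]
  have "((\<lambda>u. f u / u) has_contour_integral 2 * of_real pi * \<i> * f 0) (part_circlepath 0 1 0 (2 * pi))"
    by (simp add: circlepath_def)
  then have "((\<lambda>t. f (cis t) * \<i>) has_integral 2 * of_real pi * \<i> * f 0) {0..2 * pi}"
    by (subst (asm) has_contour_integral_part_circlepath_iff) (simp_all add: field_simps)
  from has_integral_mult_right[OF this, of "-\<i>"] show ?thesis
    by (simp add: algebra_simps)
qed

text \<open>A zero-free function on a disc has a holomorphic logarithm, and log |f| is its real
  part, so the mean value property carries over.\<close>

lemma has_integral_circle_mean_ln:
  fixes f :: "complex \<Rightarrow> complex"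
  assumes "f holomorphic_on ball 0 R" "R > 1" "\<And>z. z \<in> ball 0 R \<Longrightarrow> f z \<noteq> 0"
  shows "((\<lambda>\<theta>. ln (norm (f (cis \<theta>)))) has_integral 2 * pi * ln (norm (f 0))) {0..2 * pi}"
proof -
  obtain g where g: "g holomorphic_on ball 0 R" "\<And>z. z \<in> ball 0 R \<Longrightarrow> exp (g z) = f z"
    using holomorphic_logarithm_exists[of "ball 0 R" f 0] assms by auto
  have ln: "ln (norm (f z)) = Re (g z)" if "z \<in> ball 0 R" for z
    using g(2)[OF that] by (metis norm_exp_eq_Re ln_exp)
  have "((\<lambda>\<theta>. Re (g (cis \<theta>))) has_integral Re (2 * pi * g 0)) {0..2 * pi}"
    using has_integral_linear[OF has_integral_circle_mean[OF g(1) assms(2)] bounded_linear_Re]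
    by (simp add: o_def)
  then show ?thesis using assms(2) by (simp add: ln)
qed

lemma holomorphic_slice:
  fixes F :: "complex ^ 'n \<Rightarrow> complex ^ 'm"
  assumes "holomorphic_map_on F D" "\<And>t. t \<in> S \<Longrightarrow> z + t *s v \<in> D"
  shows "(\<lambda>t. F (z + t *s v) $ i) holomorphic_on S"
  unfolding holomorphic_on_def
proof
  fix t assume t: "t \<in> S"
  obtain A where A: "(F has_derivative (\<lambda>h. A *v h)) (at (z + t *s v))"
    using assms t unfolding holomorphic_map_on_def by blast
  have "((\<lambda>t. z + t *s v) has_derivative (\<lambda>t. 0 + t *s v)) (at t)"
    by (intro has_derivative_add has_derivative_const bounded_linear_imp_has_derivative bounded_linear_vector_smult)
  from diff_chain_at[OF this A] 
  have "((\<lambda>t. F (z + t *s v)) has_derivative (\<lambda>t. A *v (t *s v))) (at t)"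
    by (simp add: o_def)
  then have "((\<lambda>t. F (z + t *s v) $ i) has_derivative (\<lambda>t. (A *v (t *s v)) $ i)) (at t)"
    by (rule bounded_linear.has_derivative[OF bounded_linear_vec_nth])
  moreover have "(\<lambda>t. (A *v (t *s v)) $ i) = (*) ((A *v v) $ i)"
    by (auto simp: fun_eq_iff vector_scalar_commute mult.commute)
  ultimately show "(\<lambda>t. F (z + t *s v) $ i) field_differentiable at t within S"
    unfolding field_differentiable_def has_field_derivative_def
    by (metis has_derivative_at_withinI)
qed

lemma deriv_slice:
  fixes F :: "complex ^ 'n \<Rightarrow> complex ^ 'm"
  assumes "(F has_derivative (\<lambda>h. A *v h)) (at z)"
  shows "((\<lambda>t. F (z + t *s v) $ i) has_field_derivative (A *v v) $ i) (at 0)"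
proof -
  have "((\<lambda>t. z + t *s v) has_derivative (\<lambda>t. 0 + t *s v)) (at 0)"
    by (intro has_derivative_add has_derivative_const bounded_linear_imp_has_derivative bounded_linear_vector_smult)
  from diff_chain_at[OF this, of F "\<lambda>h. A *v h"] assms
  have "((\<lambda>t. F (z + t *s v)) has_derivative (\<lambda>t. A *v (t *s v))) (at 0)"
    by (simp add: o_def)
  then have "((\<lambda>t. F (z + t *s v) $ i) has_derivative (\<lambda>t. (A *v (t *s v)) $ i)) (at 0)"
    by (rule bounded_linear.has_derivative[OF bounded_linear_vec_nth])
  moreover have "(\<lambda>t. (A *v (t *s v)) $ i) = (*) ((A *v v) $ i)"
    by (auto simp: fun_eq_iff vector_scalar_commute mult.commute)
  ultimately show ?thesis by (simp add: has_field_derivative_def)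
qed

lemma holomorphic_herm_slice:
  assumes "holomorphic_map_on F D" "\<And>t. t \<in> S \<Longrightarrow> z + t *s v \<in> D"
  shows "(\<lambda>t. herm e (F (z + t *s v) - a)) holomorphic_on S"
  unfolding herm_def using holomorphic_slice[OF assms] by (auto intro!: holomorphic_intros)

lemma deriv_herm_slice:
  fixes F :: "complex ^ 'n \<Rightarrow> complex ^ 'm"
  assumes "(F has_derivative (\<lambda>h. A *v h)) (at z)"
  shows "((\<lambda>t. herm e (F (z + t *s v) - a)) has_field_derivative herm e (A *v v)) (at 0)"
  unfolding herm_def vector_minus_component
  by (auto intro!: derivative_eq_intros deriv_slice[OF assms] sum.cong)

section \<open>A Hopf lemma for \<rho> on preimages of balls\<close>

text \<open>If \<open>A\<close> is invertible, the preimage of \<open>e\<close> is mapped into the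
  line of \<open>e\<close>, which \<open>perp\<close> kills; otherwise a kernel vector serves. This
  dichotomy takes the place of a local inverse of \<open>F\<close>.\<close>

lemma exists_perp_kernel:
  fixes A :: "complex ^ 'n ^ 'n"
  assumes "norm e = 1"
  shows "\<exists>v. norm v = 1 \<and> perp e (A *v v) = 0"
proof -
  have "\<exists>v. v \<noteq> 0 \<and> perp e (A *v v) = 0"
  proof (cases "\<forall>x. A *v x = 0 \<longrightarrow> x = 0")
    case True
    then obtain B where "B ** A = mat 1" using matrix_left_invertible_ker[of A] by blast
    then have "A ** B = mat 1" by (simp add: matrix_left_right_inverse)
    then have "A *v (B *v e) = e" by (simp add: matrix_vector_mul_assoc)
    moreover from this assms have "B *v e \<noteq> 0" by auto
    ultimately show ?thesis using perp_self[OF assms] by metis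
  qed (auto simp: perp_def herm_def)
  then obtain v where v: "v \<noteq> 0" "perp e (A *v v) = 0" by blast
  define u where "u = complex_of_real (1 / norm v) *s v"
  have "norm u = 1" using v by (simp add: u_def norm_vector_smult norm_divide)
  moreover have "perp e (A *v u) = 0"
    unfolding u_def vector_scalar_commute perp_smult v(2) by simp
  ultimately show ?thesis by blast
qed

text \<open>
  The disc is taken in a direction \<open>v\<close> with \<open>perp e (F'(z) v) = 0\<close>, so that the penalty \<open>m \<parallel>perp e (F - a)\<parallel>\<^sup>2\<close>
  contributes only \<open>o(r\<^sup>2)\<close> to the circle mean, while the logarithm contributes nothing and
  \<open>\<epsilon> \<parallel>y\<parallel>\<^sup>2\<close> contributes \<open>\<epsilon> r\<^sup>2\<close>. Affine discs suffice, so no change of variables for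
  plurisubharmonic functions is needed, and \<open>F'(z)\<close> may be singular.
\<close>

lemma no_local_max:
  fixes F :: "complex ^ 'n \<Rightarrow> complex ^ 'n"
  assumes hol: "holomorphic_map_on F D" and psh: "continuous_plurisubharmonic_on D \<rho>"
    and d: "d > 0" "ball z d \<subseteq> D" and e: "norm e = 1" and c: "c \<ge> 0" and m: "m \<ge> 0" and \<epsilon>: "\<epsilon> > 0"
    and nz: "\<And>y. y \<in> ball z d \<Longrightarrow> herm e (F y - a) \<noteq> 0"
  defines "u \<equiv> \<lambda>y. \<rho> y - c * ln (norm (herm e (F y - a))) - m * (norm (perp e (F y - a)))\<^sup>2 + \<epsilon> * (norm y)\<^sup>2"
  shows "\<exists>y\<in>ball z d. u y > u z"
proof (rule ccontr)
  assume "\<not> ?thesis"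
  then have max: "u y \<le> u z" if "y \<in> ball z d" for y using that by force
  have "z \<in> D" using d by auto
  then obtain A where A: "(F has_derivative (\<lambda>h. A *v h)) (at z)"
    using hol unfolding holomorphic_map_on_def by blast
  obtain v where v: "norm v = 1" "perp e (A *v v) = 0" using exists_perp_kernel[OF e] by blast
  \<comment> \<open>Chosen so that the penalty's second-order remainder m \<eta>^2 r^2 is at most
    half of the gain \<epsilon> r^2; \<open>m + 1\<close> covers the case m = 0.\<close>
  define \<eta> where "\<eta> = sqrt (\<epsilon> / (2 * (m + 1)))"
  have \<eta>: "\<eta> > 0" "\<eta>\<^sup>2 = \<epsilon> / (2 * (m + 1))" using \<epsilon> m by (auto simp: \<eta>_def)
  have "m * \<eta>\<^sup>2 < \<epsilon>"
    unfolding \<eta>(2) using \<epsilon> m by (simp add: field_simps add_nonneg_pos)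
  obtain \<delta> where \<delta>: "\<delta> > 0" "\<And>y. norm (y - z) < \<delta> \<Longrightarrow> norm (F y - F z - A *v (y - z)) \<le> \<eta> * norm (y - z)"
    using A \<eta>(1) unfolding has_derivative_at_alt by blast
  \<comment> \<open>The factor 3 leaves room for the disc of parameter radius 2, since the mean
    value lemmas need holomorphy beyond the unit circle.\<close>
  define r where "r = min d \<delta> / 3"
  have r: "r > 0" "2 * r < d" "r < \<delta>" using d \<delta> by (auto simp: r_def)
  define w where "w = complex_of_real r *s v"
  have nw: "norm w = r" using r v by (simp add: w_def norm_vector_smult)
  have norm_tw: "norm (t *s w) = norm t * r" for t by (simp add: norm_vector_smult nw)
  have in_ball: "z + t *s w \<in> ball z d" if "t \<in> ball 0 2" for t
  proof -
    have "norm t * r \<le> 2 * r" using that r by (intro mult_right_mono) auto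
    also have "\<dots> < d" by (rule r(2))
    finally show ?thesis by (simp add: dist_norm norm_tw)
  qed
  have inD: "z + t *s w \<in> D" if "t \<in> ball 0 2" for t using in_ball[OF that] d by auto
  define P where "P = perp e (F z - a)"
  define X where "X t = perp e (F (z + t *s w) - F z)" for t
  \<comment> \<open>Maximality of \<open>u\<close> at \<open>z\<close> will give \<rho> \<le>
    \<open>B\<close> on the circle. Every nonconstant term of \<open>B\<close> is harmonic along the
    disc, so the mean of \<open>B\<close> is exactly \<rho> z + (m \<eta>^2 - \<epsilon>) r^2, which
    is less than \<rho> z.\<close>
  define B where "B \<theta> = \<rho> z + c * (ln (norm (herm e (F (z + cis \<theta> *s w) - a))) - ln (norm (herm e (F z - a))))
     + m * (2 * (P \<bullet> X (cis \<theta>)) + \<eta>\<^sup>2 * r\<^sup>2) - \<epsilon> * (2 * (z \<bullet> (cis \<theta> *s w)) + r\<^sup>2)" for \<theta>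
  have I1: "((\<lambda>\<theta>. ln (norm (herm e (F (z + cis \<theta> *s w) - a)))) has_integral
      2 * pi * ln (norm (herm e (F z - a)))) {0..2*pi}"
    using has_integral_circle_mean_ln[OF holomorphic_herm_slice[OF hol inD, where e=e and a=a]]
      nz[OF in_ball] by simp
  have I2: "((\<lambda>\<theta>. P \<bullet> X (cis \<theta>)) has_integral 0) {0..2*pi}"
  proof -
    \<comment> \<open>This is \<open>herm P (X t)\<close> written out: holomorphic in
      \<open>t\<close> and zero at the centre, so the cross term has mean zero.\<close>
    define f where "f t = herm P (F (z + t *s w) - F z) - herm e (F (z + t *s w) - F z) * herm P e" for t
    have "f holomorphic_on ball 0 2"
      unfolding f_def by (intro holomorphic_intros holomorphic_herm_slice[OF hol inD])
    from has_integral_circle_mean[OF this] have "((\<lambda>\<theta>. f (cis \<theta>)) has_integral 0) {0..2*pi}"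
      by (simp add: f_def herm_def)
    from has_integral_linear[OF this bounded_linear_Re]
    have "((\<lambda>\<theta>. Re (f (cis \<theta>))) has_integral 0) {0..2*pi}" by (simp add: o_def)
    moreover have "herm P (X t) = f t" for t
      by (simp add: f_def X_def perp_def herm_diff herm_smult left_diff_distrib)
    ultimately show ?thesis by (simp add: inner_eq_Re_herm)
  qed
  have I3: "((\<lambda>\<theta>. z \<bullet> (cis \<theta> *s w)) has_integral 0) {0..2*pi}"
  proof -
    have "(\<lambda>t. t * herm z w) holomorphic_on ball 0 2" by (intro holomorphic_intros)
    from has_integral_linear[OF has_integral_circle_mean[OF this] bounded_linear_Re] show ?thesis
      by (simp add: o_def inner_eq_Re_herm herm_smult)
  qed
  have I0: "((\<lambda>\<theta>. x) has_integral 2 * pi * x) {0..2*pi}" for x :: real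
    using has_integral_const_real[of x 0 "2 * pi"] by simp
  have "(B has_integral 2 * pi * \<rho> z + c * (2 * pi * ln (norm (herm e (F z - a))) - 2 * pi * ln (norm (herm e (F z - a))))
      + m * (2 * 0 + 2 * pi * (\<eta>\<^sup>2 * r\<^sup>2)) - \<epsilon> * (2 * 0 + 2 * pi * r\<^sup>2)) {0..2*pi}"
    unfolding B_def by (intro has_integral_add has_integral_diff has_integral_mult_right I0 I1 I2 I3)
  then have IB: "(B has_integral 2 * pi * (\<rho> z + m * \<eta>\<^sup>2 * r\<^sup>2 - \<epsilon> * r\<^sup>2)) {0..2*pi}"
    by (simp add: algebra_simps)
  have bound: "\<rho> (z + cis \<theta> *s w) \<le> B \<theta>" for \<theta>
  proof -
    define h where "h = cis \<theta> *s w"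
    have nh: "norm h = r" by (simp add: h_def norm_tw)
    have "cis \<theta> \<in> ball 0 2" by simp
    from max[OF in_ball[OF this]] have u: "u (z + h) \<le> u z" by (simp add: h_def)
    have Ah: "perp e (A *v h) = 0"
      unfolding h_def w_def vector_scalar_commute perp_smult v(2) by simp
    have "norm (X (cis \<theta>)) = norm (perp e (F (z + h) - F z - A *v h))"
      unfolding X_def h_def[symmetric] perp_diff[of e _ "A *v h"] Ah by simp
    also have "\<dots> \<le> norm (F (z + h) - F z - A *v h)" by (rule perp_norm_le[OF e])
    also have "\<dots> \<le> \<eta> * r" using \<delta>(2)[of "z + h"] nh r by simp
    finally have X: "(norm (X (cis \<theta>)))\<^sup>2 \<le> \<eta>\<^sup>2 * r\<^sup>2"
      by (metis norm_ge_zero power_mono power_mult_distrib)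
    have "perp e (F (z + h) - a) = P + X (cis \<theta>)"
      unfolding P_def X_def h_def[symmetric] by (simp flip: perp_add)
    then have "(norm (perp e (F (z + h) - a)))\<^sup>2 = (norm P)\<^sup>2 + 2 * (P \<bullet> X (cis \<theta>)) + (norm (X (cis \<theta>)))\<^sup>2"
      by (simp add: power2_norm_eq_inner inner_add_left inner_add_right inner_commute)
    with X have "m * (norm (perp e (F (z + h) - a)))\<^sup>2 \<le> m * ((norm P)\<^sup>2 + 2 * (P \<bullet> X (cis \<theta>)) + \<eta>\<^sup>2 * r\<^sup>2)"
      using m by (intro mult_left_mono) auto
    moreover have "(norm (z + h))\<^sup>2 = (norm z)\<^sup>2 + 2 * (z \<bullet> h) + r\<^sup>2"
      unfolding nh[symmetric] by (simp add: power2_norm_eq_inner inner_add_left inner_add_right inner_commute)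
    ultimately show ?thesis
      using u unfolding u_def B_def h_def[symmetric] P_def by (simp add: algebra_simps)
  qed
  have cont: "continuous_on {0..2*pi} (\<lambda>\<theta>. \<rho> (z + cis \<theta> *s w))"
  proof (rule continuous_on_compose2[where g = \<rho> and f = "\<lambda>\<theta>. z + cis \<theta> *s w"])
    show "continuous_on D \<rho>" using psh by (simp add: continuous_plurisubharmonic_on_def)
    show "continuous_on {0..2*pi} (\<lambda>\<theta>. z + cis \<theta> *s w)"
      by (intro continuous_intros bounded_linear.continuous_on[OF bounded_linear_vector_smult] continuous_on_cis)
  qed (use inD in auto)
  define I where "I = integral {0..2*pi} (\<lambda>\<theta>. \<rho> (z + cis \<theta> *s w))"
  have "\<rho> z \<le> 1 / (2 * pi) * I"
    using psh inD unfolding continuous_plurisubharmonic_on_def I_def by auto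
  moreover have "I \<le> 2 * pi * (\<rho> z + m * \<eta>\<^sup>2 * r\<^sup>2 - \<epsilon> * r\<^sup>2)"
    unfolding I_def using has_integral_le[OF integrable_integral[OF integrable_continuous_real[OF cont]] IB] bound by simp
  then have "1 / (2 * pi) * I \<le> 1 / (2 * pi) * (2 * pi * (\<rho> z + m * \<eta>\<^sup>2 * r\<^sup>2 - \<epsilon> * r\<^sup>2))"
    by (rule mult_left_mono) simp
  then have "1 / (2 * pi) * I \<le> \<rho> z + m * \<eta>\<^sup>2 * r\<^sup>2 - \<epsilon> * r\<^sup>2" by simp
  ultimately have "\<epsilon> * r\<^sup>2 \<le> m * \<eta>\<^sup>2 * r\<^sup>2" by linarith
  then show False using \<open>m * \<eta>\<^sup>2 < \<epsilon>\<close> r by simp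
qed

lemma holomorphic_map_on_imp_continuous_on:
  "holomorphic_map_on F D \<Longrightarrow> continuous_on D F"
  unfolding holomorphic_map_on_def
  by (meson continuous_at_imp_continuous_on has_derivative_continuous)

text \<open>
  The barrier is Hopf's on the complex line through \<open>a\<close> and \<open>F z0\<close>, with the line itself enforced by the
  penalty. The coefficient \<open>4 c / R\<^sup>2\<close> is large enough to make the barrier nonpositive wherever
  the region \<open>A\<close> touches the sphere of radius \<open>R\<close>.
\<close>

lemma hopf_ball:
  fixes F :: "complex ^ 'n \<Rightarrow> complex ^ 'n"
  assumes hol: "holomorphic_map_on F D" and "open D"
    and psh: "continuous_plurisubharmonic_on D \<rho>" and neg: "\<And>z. z \<in> D \<Longrightarrow> \<rho> z < 0"
    and proper: "\<And>K. compact K \<Longrightarrow> K \<subseteq> \<Omega> \<Longrightarrow> compact {z \<in> D. F z \<in> K}"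
    and R: "R > 0" "cball a R \<subseteq> \<Omega>" and c: "c > 0"
    and le: "\<And>z. z \<in> D \<Longrightarrow> F z \<in> cball a (3 * R / 4) \<Longrightarrow> \<rho> z \<le> - c"
    and z0: "z0 \<in> D" "F z0 \<in> cball a (7 * R / 8)"
  shows "\<rho> z0 \<le> - c / 8"
proof (rule ccontr)
  assume "\<not> ?thesis"
  then have \<sigma>: "\<rho> z0 + c / 8 > 0" by simp
  define \<sigma> where "\<sigma> = \<rho> z0 + c / 8"
  define N where "N = norm (F z0 - a)"
  have N: "3 * R / 4 < N" "N \<le> 7 * R / 8"
    using le[OF z0(1)] \<sigma> c z0(2) by (force simp: N_def dist_norm norm_minus_commute)+
  then have N0: "N > 0" using R by simp
  define e where "e = (F z0 - a) /\<^sub>R N"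
  have e: "norm e = 1" using N0 by (simp add: e_def N_def)
  have F0: "F z0 - a = complex_of_real N *s e" using N0 by (simp add: e_def flip: scaleR_eq_vector_smult)
  have herm0: "herm e (F z0 - a) = N" and perp0: "perp e (F z0 - a) = 0"
    unfolding F0 herm_smult perp_smult perp_self[OF e] herm_self e by simp_all
  have contF: "continuous_on D F" using hol by (rule holomorphic_map_on_imp_continuous_on)
  have cont\<rho>: "continuous_on D \<rho>" using psh by (simp add: continuous_plurisubharmonic_on_def)
  have conth: "continuous_on S (\<lambda>x. herm e (f x))" if "continuous_on S f" for S :: "(complex^'n) set" and f
    using that by (rule bounded_linear.continuous_on[OF bounded_linear_herm])
  \<comment> \<open>The ball without a tube around the complex hyperplane
    \<open>herm e (w - a) = 0\<close>: the logarithm is finite here, and \<open>F z0\<close> belongs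
    to it because \<open>N > 3 * R / 4\<close>.\<close>
  define A where "A = {w \<in> cball a R. R / 2 \<le> norm (herm e (w - a))}"
  have "compact A"
  proof -
    have "A = cball a R \<inter> {w. R / 2 \<le> norm (herm e (w - a))}" by (auto simp: A_def)
    moreover have "closed {w. R / 2 \<le> norm (herm e (w - a))}"
      by (intro closed_Collect_le continuous_intros conth)
    ultimately show ?thesis by (simp add: compact_Int_closed)
  qed
  define X where "X = {z \<in> D. F z \<in> A}"
  have "compact X" unfolding X_def using \<open>compact A\<close> R(2) by (intro proper) (auto simp: A_def)
  have "z0 \<in> X" using z0 N R
    by (auto simp: X_def A_def herm0 N_def dist_norm norm_minus_commute)
  obtain M where M: "\<And>z. z \<in> X \<Longrightarrow> norm z \<le> M"
    using \<open>compact X\<close> compact_imp_bounded bounded_iff by metis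
  \<comment> \<open>Small enough that \<epsilon> |y|^2 never uses up the excess \<sigma> on the
    bounded set \<open>X\<close>.\<close>
  define \<epsilon> where "\<epsilon> = \<sigma> / (M\<^sup>2 + 1)"
  have M1: "M\<^sup>2 + 1 > 0" using zero_le_power2[of M] by linarith
  have \<epsilon>: "\<epsilon> > 0" "\<epsilon> * M\<^sup>2 < \<sigma>" using \<sigma> M1 by (simp_all add: \<epsilon>_def \<sigma>_def field_simps)
  define u where "u y = \<rho> y - c * ln (norm (herm e (F y - a)))
      - (4 * c / R\<^sup>2) * (norm (perp e (F y - a)))\<^sup>2 + \<epsilon> * (norm y)\<^sup>2" for y
  have "X \<subseteq> D" by (auto simp: X_def)
  have nzX: "herm e (F y - a) \<noteq> 0" if "y \<in> X" for y
    using that R by (auto simp: X_def A_def)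
  have "continuous_on X u"
    unfolding u_def perp_def
    by (intro continuous_intros conth continuous_on_subset[OF contF \<open>X \<subseteq> D\<close>] continuous_on_subset[OF cont\<rho> \<open>X \<subseteq> D\<close>]
        bounded_linear.continuous_on[OF bounded_linear_vector_smult]) (use nzX in auto)
  then obtain zm where zm: "zm \<in> X" "\<And>y. y \<in> X \<Longrightarrow> u y \<le> u zm"
    using continuous_attains_sup[OF \<open>compact X\<close>] \<open>z0 \<in> X\<close> by blast
  \<comment> \<open>The origin of the 1/8 in the conclusion: \<open>N / R\<close> is at most 7/8,
    and ln t \<le> t - 1.\<close>
  have "c * ln N \<le> c * (ln R - 1 / 8)"
  proof -
    have "ln (N / R) \<le> N / R - 1" using N0 R by (intro ln_le_minus_one) simp
    also have "\<dots> \<le> - 1 / 8" using N R by (simp add: field_simps)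
    finally show ?thesis using N0 R c by (intro mult_left_mono) (auto simp: ln_div)
  qed
  moreover have "0 \<le> \<epsilon> * (norm z0)\<^sup>2" using \<epsilon>(1) by simp
  ultimately have "\<sigma> - c * ln R \<le> u z0" using N0
    by (simp add: u_def herm0 perp0 \<sigma>_def algebra_simps)
  also have "\<dots> \<le> u zm" using zm \<open>z0 \<in> X\<close> by blast
  finally have um: "\<sigma> - c * ln R \<le> u zm" .
  define x where "x = norm (herm e (F zm - a))"
  define s where "s = (norm (perp e (F zm - a)))\<^sup>2"
  have xs: "(norm (F zm - a))\<^sup>2 = x\<^sup>2 + s" unfolding x_def s_def by (rule norm_decomp[OF e])
  have x: "R / 2 \<le> x" and le_R: "norm (F zm - a) \<le> R" and "zm \<in> D"
    using zm(1) by (auto simp: X_def A_def x_def dist_norm norm_minus_commute)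
  have x0: "x > 0" using x R by simp
  have "s \<ge> 0" by (simp add: s_def)
  have um_eq: "u zm = \<rho> zm - c * ln x - (4 * c / R\<^sup>2) * s + \<epsilon> * (norm zm)\<^sup>2"
    by (simp add: u_def x_def s_def)
  have "\<epsilon> * (norm zm)\<^sup>2 \<le> \<epsilon> * M\<^sup>2" using \<epsilon>(1) M[OF zm(1)] by (intro mult_left_mono power_mono) auto
  then have um2: "- c * ln R < \<rho> zm - c * ln x - (4 * c / R\<^sup>2) * s"
    using um \<epsilon>(2) unfolding um_eq by linarith
  have pos: "0 < \<rho> zm + c * (ln (R / x) - 4 * (s / R\<^sup>2))"
    using um2 R x0 by (simp add: ln_div algebra_simps)
  \<comment> \<open>On the outer sphere s = (R - x) (R + x) \<ge> (R - x) R, so ln (R / x) is at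
    most 2 s / R^2 and the penalty absorbs it; \<rho> < 0 then contradicts
    \<open>pos\<close>.\<close>
  have "norm (F zm - a) < R"
  proof (rule ccontr)
    assume "\<not> ?thesis"
    then have eq: "R\<^sup>2 = x\<^sup>2 + s" using le_R xs by (metis order_antisym_conv linorder_not_less)
    have xR: "x \<le> R" using eq \<open>s \<ge> 0\<close> R x0 by (intro power2_le_imp_le[of x R]) auto
    have "ln (R / x) \<le> R / x - 1" using x0 R by (intro ln_le_minus_one) simp
    also have "\<dots> = (R - x) / x" using x0 by (simp add: field_simps)
    also have "\<dots> \<le> (R - x) / (R / 2)" using x xR R x0 by (intro divide_left_mono) auto
    also have "\<dots> = 2 * ((R - x) * R / R\<^sup>2)" using R by (simp add: power2_eq_square)
    also have "\<dots> \<le> 2 * (s / R\<^sup>2)"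
    proof -
      have "(R - x) * R \<le> s" using eq xR x0 mult_nonneg_nonneg[of "R - x" x]
        by (simp add: power2_eq_square algebra_simps)
      then show ?thesis using R by (intro mult_left_mono divide_right_mono) auto
    qed
    also have "\<dots> \<le> 4 * (s / R\<^sup>2)" using \<open>s \<ge> 0\<close> by (intro mult_right_mono) auto
    finally have "c * (ln (R / x) - 4 * (s / R\<^sup>2)) \<le> 0" using c by (intro mult_nonneg_nonpos) auto
    then show False using pos neg[OF \<open>zm \<in> D\<close>] by simp
  qed
  \<comment> \<open>On the inner wall ln (R / x) = ln 2 \<le> 1. Within radius 3 R / 4 the bound
    \<rho> \<le> - c outweighs this; beyond it s \<ge> 5 R^2 / 16, so the penalty does. The maximum
    point is therefore interior to \<open>X\<close>.\<close>
  moreover have "R / 2 < x"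
  proof (rule ccontr)
    assume "\<not> ?thesis"
    then have xe: "x = R / 2" using x by simp
    have ln2: "ln (R / x) \<le> 1" using R ln_le_minus_one[of 2] by (simp add: xe)
    show False
    proof (cases "norm (F zm - a) \<le> 3 * R / 4")
      case True
      then have "\<rho> zm \<le> - c" using le \<open>zm \<in> D\<close> by (simp add: dist_norm norm_minus_commute)
      moreover have "c * (ln (R / x) - 4 * (s / R\<^sup>2)) \<le> c * 1"
        using ln2 \<open>s \<ge> 0\<close> c by (intro mult_left_mono) (auto intro: order_trans[of _ "ln (R/x)"])
      ultimately show False using pos by simp
    next
      case False
      then have "(3 * R / 4)\<^sup>2 \<le> (norm (F zm - a))\<^sup>2" using R by (intro power_mono) auto
      then have "9 / 16 * R\<^sup>2 \<le> R\<^sup>2 / 4 + s" unfolding xs xe by (simp add: power2_eq_square)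
      then have "R\<^sup>2 / 4 \<le> s" using zero_le_power2[of R] by linarith
      then have "1 \<le> 4 * (s / R\<^sup>2)" using R by (simp add: field_simps)
      then have "c * (ln (R / x) - 4 * (s / R\<^sup>2)) \<le> 0" using c ln2 by (intro mult_nonneg_nonpos) auto
      then show False using pos neg[OF \<open>zm \<in> D\<close>] by simp
    qed
  qed
  ultimately have "zm \<in> D \<inter> F -` {w. norm (w - a) < R \<and> R / 2 < norm (herm e (w - a))}"
    using \<open>zm \<in> D\<close> by (simp add: x_def)
  moreover have "open (D \<inter> F -` {w. norm (w - a) < R \<and> R / 2 < norm (herm e (w - a))})"
    by (intro continuous_open_preimage contF \<open>open D\<close> open_Collect_conj open_Collect_less continuous_intros conth)
  ultimately obtain d where d: "d > 0" "ball zm d \<subseteq> D \<inter> F -` {w. norm (w - a) < R \<and> R / 2 < norm (herm e (w - a))}"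
    using open_contains_ball by blast
  have dX: "ball zm d \<subseteq> X" using d(2) by (auto simp: X_def A_def dist_norm norm_minus_commute)
  have "\<exists>y\<in>ball zm d. u y > u zm"
    unfolding u_def
    by (rule no_local_max[OF hol psh d(1) _ e]) (use c \<epsilon> dX \<open>X \<subseteq> D\<close> nzX in auto)
  then show False using zm(2) dX by force
qed

section \<open>Power decay of \<rho> by a chain of balls\<close>

text \<open>Reaching scale \<tau> takes about log \<tau> / log \<kappa> links, each dividing the
  bound by 8. With \<kappa>^k = 1/8 the total loss is of order \<tau>^k, and \<tau> is bounded below
  by a multiple of the boundary distance.\<close>

lemma psh_power_decay:
  fixes F :: "complex ^ 'n \<Rightarrow> complex ^ 'n"
  assumes hol: "holomorphic_map_on F D" and "open D"
    and psh: "continuous_plurisubharmonic_on D \<rho>" and neg: "\<And>z. z \<in> D \<Longrightarrow> \<rho> z < 0"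
    and proper: "\<And>K. compact K \<Longrightarrow> K \<subseteq> \<Omega> \<Longrightarrow> compact {z \<in> D. F z \<in> K}"
    and G: "open G" "convex G" "bounded G" "G \<noteq> {}" "G \<subseteq> \<Omega>"
  shows "\<exists>c>0. \<exists>k>0. \<forall>z\<in>D. F z \<in> G \<longrightarrow> \<rho> z \<le> - c * infdist (F z) (- G) powr k"
proof -
  obtain a where a: "a \<in> G" using G by blast
  obtain s where s: "s > 0" "cball a s \<subseteq> G" using G(1) a open_contains_cball by blast
  obtain d where d: "d \<ge> s" "\<And>x y. x \<in> G \<Longrightarrow> y \<in> G \<Longrightarrow> norm (x - y) \<le> d"
    using diameter_bounded_bound[OF G(3)] by (metis dist_norm max.cobounded1 max.coboundedI2)
  have d0: "d > 0" using d s by simp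
  \<comment> \<open>A negative continuous function has a negative maximum on the compact preimage of
    the base ball; an empty preimage imposes nothing, so 1 serves.\<close>
  obtain c0 where c0: "c0 > 0" "\<And>z. z \<in> D \<Longrightarrow> F z \<in> cball a s \<Longrightarrow> \<rho> z \<le> - c0"
  proof (cases "{z \<in> D. F z \<in> cball a s} = {}")
    case True then show ?thesis using that[of 1] by auto
  next
    case False
    have "compact {z \<in> D. F z \<in> cball a s}" using s G by (intro proper) auto
    moreover have "continuous_on {z \<in> D. F z \<in> cball a s} \<rho>"
      using psh by (auto simp: continuous_plurisubharmonic_on_def intro: continuous_on_subset)
    ultimately obtain x where "x \<in> {z \<in> D. F z \<in> cball a s}" "\<forall>y\<in>{z \<in> D. F z \<in> cball a s}. \<rho> y \<le> \<rho> x"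
      using continuous_attains_sup[OF _ False] by blast
    then show ?thesis using that[of "- \<rho> x"] neg by auto
  qed
  \<comment> \<open>the ratio for which the balls of radii \<open>s \<kappa>\<^sup>j\<close> overlap enough for \<open>hopf_ball\<close> to pass from one to the next\<close>
  define \<kappa> where "\<kappa> = 1 - s / (8 * d)"
  have \<kappa>: "0 < \<kappa>" "\<kappa> < 1" using d0 d(1) s(1) by (auto simp: \<kappa>_def field_simps)
  define k where "k = ln 8 / ln (1 / \<kappa>)"
  have lk: "ln (1 / \<kappa>) > 0" using \<kappa> by simp
  have k: "k > 0" using lk by (simp add: k_def)
  have \<kappa>k: "\<kappa> powr k = 1 / 8"
  proof -
    have "k * ln \<kappa> = - ln 8" using lk \<kappa> by (simp add: k_def ln_div field_simps)
    then show ?thesis using \<kappa> by (simp add: powr_def exp_minus)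
  qed
  have \<kappa>jk: "(\<kappa> ^ j) powr k = 1 / 8 ^ j" for j
  proof -
    have "(\<kappa> ^ j) powr k = (\<kappa> powr k) ^ j"
      using \<kappa> by (simp add: powr_def ln_realpow mult.left_commute flip: exp_of_nat_mult)
    then show ?thesis by (simp add: \<kappa>k power_divide)
  qed
  \<comment> \<open>These balls are the images of \<open>cball a s\<close> under the homotheties
    with centre \<open>w\<close> and ratio \<tau>; convexity keeps them in \<open>G\<close>.\<close>
  have cone: "cball (a + (1 - \<tau>) *\<^sub>R (w - a)) (\<tau> * s) \<subseteq> G" if w: "w \<in> G" and \<tau>: "0 < \<tau>" "\<tau> \<le> 1" for w \<tau>
  proof
    fix x assume x: "x \<in> cball (a + (1 - \<tau>) *\<^sub>R (w - a)) (\<tau> * s)"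
    define y where "y = a + (1 / \<tau>) *\<^sub>R (x - (a + (1 - \<tau>) *\<^sub>R (w - a)))"
    have "norm (x - (a + (1 - \<tau>) *\<^sub>R (w - a))) \<le> \<tau> * s"
      using x by (simp add: dist_norm norm_minus_commute)
    then have "norm (y - a) \<le> s" unfolding y_def using \<tau> by (simp add: pos_divide_le_eq mult.commute)
    then have "y \<in> cball a s" by (simp add: dist_norm norm_minus_commute)
    moreover have "x = (1 - \<tau>) *\<^sub>R w + \<tau> *\<^sub>R y"
      using \<tau> by (simp add: y_def algebra_simps)
    ultimately show "x \<in> G" using convexD_alt[OF G(2) w, of y \<tau>] s \<tau> by auto
  qed
  have chain: "\<rho> z \<le> - (c0 / 8 ^ j)"
    if "w \<in> G" "z \<in> D" "F z \<in> cball (a + (1 - \<kappa> ^ j) *\<^sub>R (w - a)) (3 * (\<kappa> ^ j * s) / 4)" for w z j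
    using that(2,3)
  proof (induction j arbitrary: z)
    case 0
    then have "F z \<in> cball a s" using s(1) by simp
    then show ?case using c0(2) 0 by simp
  next
    case (Suc j)
    define p where "p = \<kappa> ^ j"
    have p: "0 < p" "p \<le> 1" using \<kappa> by (auto simp: p_def power_le_one)
    have "\<rho> z \<le> - (c0 / 8 ^ j) / 8"
    proof (rule hopf_ball[OF hol \<open>open D\<close> psh neg proper])
      show "p * s > 0" using p s by simp
      show "cball (a + (1 - p) *\<^sub>R (w - a)) (p * s) \<subseteq> \<Omega>" using cone[OF that(1) p] G by blast
      show "\<rho> z \<le> - (c0 / 8 ^ j)" if "z \<in> D" "F z \<in> cball (a + (1 - p) *\<^sub>R (w - a)) (3 * (p * s) / 4)" for z
        using Suc.IH that by (simp add: p_def)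
      \<comment> \<open>Consecutive centres differ by at most (1 - \<kappa>) p d = p s / 8, and 3/4
        + 1/8 = 7/8 is precisely what \<open>hopf_ball\<close> tolerates.\<close>
      have "dist (a + (1 - p) *\<^sub>R (w - a)) (F z) \<le>
         dist (a + (1 - p) *\<^sub>R (w - a)) (a + (1 - \<kappa> * p) *\<^sub>R (w - a)) + dist (a + (1 - \<kappa> * p) *\<^sub>R (w - a)) (F z)"
        by (rule dist_triangle)
      also have "dist (a + (1 - p) *\<^sub>R (w - a)) (a + (1 - \<kappa> * p) *\<^sub>R (w - a)) = norm (((1 - \<kappa>) * p) *\<^sub>R (a - w))"
        by (simp add: dist_norm algebra_simps)
      also have "\<dots> \<le> (1 - \<kappa>) * p * d" using \<kappa> p d(2)[OF a that(1)] by (simp add: mult_left_mono)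
      also have "\<dots> = p * s / 8" using d0 by (simp add: \<kappa>_def)
      also have "dist (a + (1 - \<kappa> * p) *\<^sub>R (w - a)) (F z) \<le> 3 * (\<kappa> * p * s) / 4"
        using Suc.prems(2) by (simp add: p_def)
      also have "\<kappa> * p * s \<le> 1 * p * s" using \<kappa> p s by (intro mult_right_mono) auto
      finally show "F z \<in> cball (a + (1 - p) *\<^sub>R (w - a)) (7 * (p * s) / 8)" by simp
    qed (use c0(1) Suc.prems in auto)
    then show ?case by (simp add: mult.commute)
  qed
  have "\<rho> z \<le> - (c0 / (2 * d) powr k) * infdist (F z) (- G) powr k" if z: "z \<in> D" "F z \<in> G" for z
  proof -
    define \<delta> where "\<delta> = infdist (F z) (- G)"
    have cG: "closed (- G)" "- G \<noteq> {}"
      using G(1,3) not_bounded_UNIV[where 'a = "complex ^ 'n"] by (auto, metis double_compl Compl_empty_eq)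
    have \<delta>: "\<delta> > 0"
      unfolding \<delta>_def using cG z(2) by (metis ComplD infdist_pos_not_in_closed)
    have \<delta>G: "y \<in> G" if "dist (F z) y < \<delta>" for y
      using that infdist_le[of y "- G" "F z"] by (force simp: \<delta>_def)
    define n where "n = norm (F z - a)"
    obtain e where e: "norm e = 1" "F z - a = n *\<^sub>R e"
    proof (cases "F z = a")
      case True then show ?thesis using that vector_choose_size[of 1] by (metis n_def norm_zero right_minus_eq scaleR_zero_left zero_le_one)
    next
      case False then show ?thesis using that[of "(F z - a) /\<^sub>R n"] by (simp add: n_def)
    qed
    have n: "n \<ge> 0" by (simp add: n_def)
    \<comment> \<open>The apex of the cone lies \<delta> / 2 beyond \<open>F z\<close> as seen from
      \<open>a\<close>, still in \<open>G\<close>. Thus \<open>F z\<close> is on the axis, at a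
      ratio \<tau> \<ge> \<delta> / (2 d). If \<open>F z = a\<close>, any unit direction
      \<open>e\<close> will do.\<close>
    define w where "w = a + (n + \<delta> / 2) *\<^sub>R e"
    have Fz: "F z = a + n *\<^sub>R e" using e(2) by (simp add: algebra_simps)
    have "w \<in> G" using e(1) \<delta> by (intro \<delta>G) (simp add: Fz w_def dist_norm algebra_simps flip: scaleR_right_distrib scaleR_left_diff_distrib)
    have wd: "n + \<delta> / 2 \<le> d" using d(2)[OF \<open>w \<in> G\<close> a] e(1) n \<delta> by (simp add: w_def)
    define \<tau> where "\<tau> = \<delta> / 2 / (n + \<delta> / 2)"
    have n\<delta>: "n + \<delta> / 2 > 0" using n \<delta> by simp
    have \<tau>: "0 < \<tau>" "\<tau> \<le> 1" "\<delta> / (2 * d) \<le> \<tau>"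
      using n \<delta> wd d0 n\<delta> by (auto simp: \<tau>_def divide_simps)
    \<comment> \<open>The least such \<open>N\<close> is positive, and \<open>j = N - 1\<close>
      brackets \<tau> between two consecutive powers of \<kappa>; \<open>F z\<close> is then close
      to the centre of the \<open>j\<close>-th ball.\<close>
    obtain N where N: "\<kappa> ^ N < \<tau>" "\<And>i. i < N \<Longrightarrow> \<not> \<kappa> ^ i < \<tau>"
      using real_arch_pow_inv[OF \<tau>(1) \<kappa>(2)] exists_least_iff[of "\<lambda>N. \<kappa> ^ N < \<tau>"] by blast
    have "N \<noteq> 0" using N(1) \<tau>(2) by (intro notI) simp
    then obtain j where j: "N = Suc j" using not0_implies_Suc by blast
    have j1: "\<kappa> * \<kappa> ^ j < \<tau>" and j2: "\<tau> \<le> \<kappa> ^ j" using N j by (auto simp: not_less)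
    have Fz': "F z = a + (1 - \<tau>) *\<^sub>R (w - a)"
    proof -
      have "(1 - \<tau>) * (n + \<delta> / 2) = n" using n\<delta> by (simp add: \<tau>_def field_simps)
      then show ?thesis by (simp add: w_def Fz)
    qed
    have "\<rho> z \<le> - (c0 / 8 ^ j)"
    proof (rule chain[OF \<open>w \<in> G\<close> z(1)])
      have "dist (a + (1 - \<kappa> ^ j) *\<^sub>R (w - a)) (F z) = norm ((\<kappa> ^ j - \<tau>) *\<^sub>R (w - a))"
        unfolding Fz' by (simp add: dist_norm abs_minus_commute flip: scaleR_left_diff_distrib)
      also have "\<dots> = (\<kappa> ^ j - \<tau>) * norm (w - a)" using j2 by simp
      also have "\<dots> \<le> (\<kappa> ^ j * (1 - \<kappa>)) * d"
        using j1 j2 \<kappa> d(2)[OF \<open>w \<in> G\<close> a] by (intro mult_mono) (auto simp: algebra_simps)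
      also have "\<dots> = \<kappa> ^ j * s / 8" using d0 by (simp add: \<kappa>_def)
      also have "\<dots> \<le> 3 * (\<kappa> ^ j * s) / 4" using \<kappa> s by simp
      finally show "F z \<in> cball (a + (1 - \<kappa> ^ j) *\<^sub>R (w - a)) (3 * (\<kappa> ^ j * s) / 4)" by simp
    qed
    also have "\<dots> = - (c0 * (\<kappa> ^ j) powr k)" by (simp add: \<kappa>jk)
    also have "(\<delta> / (2 * d)) powr k \<le> (\<kappa> ^ j) powr k"
      using \<tau> j2 k \<delta> d0 by (intro powr_mono2) auto
    then have "- (c0 * (\<kappa> ^ j) powr k) \<le> - (c0 * (\<delta> / (2 * d)) powr k)" using c0(1) by simp
    also have "\<dots> = - (c0 / (2 * d) powr k) * \<delta> powr k"
      using \<delta> d0 by (simp add: powr_divide)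
    finally show ?thesis by (simp add: \<delta>_def)
  qed
  then show ?thesis using c0(1) d0 k by (intro exI[of _ "c0 / (2 * d) powr k"] conjI exI[of _ k]) auto
qed

section \<open>Derivative bounds for maps into a convex set\<close>

text \<open>The circle mean of \<open>Re g\<close> is taken against the nonnegative kernel \<open>1 + Re (2 \<zeta> e\<^sup>-\<^sup>i\<^sup>\<theta>)\<close>.\<close>

lemma Re_le_imp_Re_linear_part_le:
  assumes hol: "g holomorphic_on ball 0 R" and R: "R > 1" and le: "\<And>t. t \<in> ball 0 R \<Longrightarrow> Re (g t) \<le> K"
    and g': "(g has_field_derivative g') (at 0)" and \<zeta>: "norm \<zeta> \<le> 1 / 2"
  shows "Re (g 0 + \<zeta> * g') \<le> K"
proof -
  define k where "k \<theta> = 1 + Re (2 * \<zeta> * cis (- \<theta>))" for \<theta>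
  have k: "k \<theta> \<ge> 0" for \<theta>
    using abs_Re_le_cmod[of "2 * \<zeta> * cis (- \<theta>)"] \<zeta> by (simp add: k_def norm_mult)
  have contour: "((\<lambda>\<theta>. g (cis \<theta>) * cis (- \<theta>)) has_integral 2 * pi * g') {0..2*pi}"
  proof -
    have c: "continuous_on (cball 0 1) g"
      using hol R by (intro holomorphic_on_imp_continuous_on holomorphic_on_subset[OF hol]) auto
    have h: "g holomorphic_on ball 0 1" using R by (intro holomorphic_on_subset[OF hol]) auto
    have 0: "0 \<in> ball (0::complex) 1" by simp
    define I where "I = contour_integral (circlepath 0 1) (\<lambda>u. g u / (u - 0)\<^sup>2)"
    have "g' = 1 / (2 * of_real pi * \<i>) * I"
      unfolding I_def by (rule DERIV_unique[OF g' Cauchy_derivative_integral_circlepath(2)[OF c h 0]])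
    then have I: "I = 2 * of_real pi * \<i> * g'" by simp
    have "((\<lambda>u. g u / u\<^sup>2) has_contour_integral I) (part_circlepath 0 1 0 (2 * pi))"
      using has_contour_integral_integral[OF Cauchy_derivative_integral_circlepath(1)[OF c h 0]]
      by (simp add: I_def circlepath_def)
    then have "((\<lambda>t. g (cis t) / (cis t)\<^sup>2 * \<i> * cis t) has_integral I) {0..2 * pi}"
      by (subst (asm) has_contour_integral_part_circlepath_iff) simp_all
    from has_integral_mult_right[OF this, of "-\<i>"] show ?thesis
      by (simp add: I power2_eq_square field_simps cis_inverse[symmetric] flip: cis_inverse)
  qed
  have mean: "((\<lambda>\<theta>. g (cis \<theta>)) has_integral 2 * pi * g 0) {0..2*pi}"
    by (rule has_integral_circle_mean[OF hol R])
  have "(\<lambda>t. g t * t) holomorphic_on ball 0 R" by (intro holomorphic_intros hol)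
  from has_integral_circle_mean[OF this R]
  have anti: "((\<lambda>\<theta>. g (cis \<theta>) * cis \<theta>) has_integral 0) {0..2*pi}" by simp
  \<comment> \<open>The kernel \<open>k\<close> is real and equals 1 + \<zeta> e^(-i\<theta>) + cnj
    \<zeta> e^(i\<theta>), so Re (g) k is the real part of this sum. The last term contributes
    nothing: g(t) t vanishes at 0.\<close>
  have "((\<lambda>\<theta>. g (cis \<theta>) + \<zeta> * (g (cis \<theta>) * cis (- \<theta>)) + cnj \<zeta> * (g (cis \<theta>) * cis \<theta>)) has_integral
      2 * pi * g 0 + \<zeta> * (2 * pi * g') + cnj \<zeta> * 0) {0..2*pi}"
    by (intro has_integral_add has_integral_mult_right mean contour anti)
  from has_integral_linear[OF this bounded_linear_Re]
  have "((\<lambda>\<theta>. Re (g (cis \<theta>)) * k \<theta>) has_integral 2 * pi * Re (g 0 + \<zeta> * g')) {0..2*pi}"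
    by (simp add: o_def k_def algebra_simps)
  moreover have "((\<lambda>\<theta>. K * k \<theta>) has_integral 2 * pi * K) {0..2*pi}"
  proof -
    have "(\<lambda>t. K * (1 + 2 * cnj \<zeta> * t)) holomorphic_on ball 0 2" by (intro holomorphic_intros)
    from has_integral_linear[OF has_integral_circle_mean[OF this] bounded_linear_Re]
    show ?thesis by (simp add: o_def k_def)
  qed
  moreover have "Re (g (cis \<theta>)) * k \<theta> \<le> K * k \<theta>" for \<theta>
    using le[of "cis \<theta>"] R k by (intro mult_right_mono) auto
  ultimately have "2 * pi * Re (g 0 + \<zeta> * g') \<le> 2 * pi * K"
    using has_integral_le by (metis (no_types, lifting))
  then show ?thesis by simp
qed

text \<open>A point \<open>F z + \<zeta> *s v\<close> outside the closure would be cut off by a real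
  hyperplane. The real part of the corresponding complex functional of \<open>F\<close> is bounded
  on the disc, hence so is its linear part for |\<zeta>| \<le> 1/2, a contradiction.\<close>

lemma directional_dist_ge:
  fixes F :: "complex ^ 'n \<Rightarrow> complex ^ 'n"
  assumes hol: "holomorphic_map_on F D" and A: "(F has_derivative (\<lambda>h. A *v h)) (at z)"
    and G: "open G" "convex G" "bounded G"
    and R: "R > 1" "\<And>t. t \<in> ball 0 R \<Longrightarrow> z + t *s w \<in> D" "\<And>t. t \<in> ball 0 R \<Longrightarrow> F (z + t *s w) \<in> G"
    and nz: "A *v w \<noteq> 0"
  shows "norm (A *v w) / 2 \<le> directional_dist G (F z) (A *v w)"
proof -
  define v where "v = A *v w"
  have v0: "norm v > 0" using nz by (simp add: v_def)
  have "F z \<in> G" using R(3)[of 0] R(1) by simp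
  have cl: "F z + \<zeta> *s v \<in> closure G" if \<zeta>: "norm \<zeta> \<le> 1 / 2" for \<zeta>
  proof (rule ccontr)
    assume "F z + \<zeta> *s v \<notin> closure G"
    then obtain a b where ab: "a \<bullet> (F z + \<zeta> *s v) < b" "\<And>x. x \<in> closure G \<Longrightarrow> b < a \<bullet> x"
      using separating_hyperplane_closed_point[OF convex_closure[OF G(2)] closed_closure] by blast
    have "Re (herm (-a) (F (z + 0 *s w) - 0) + \<zeta> * herm (-a) (A *v w)) \<le> - b"
    proof (rule Re_le_imp_Re_linear_part_le[OF holomorphic_herm_slice[OF hol R(2)] R(1) _ deriv_herm_slice[OF A] \<zeta>])
      fix t :: complex assume "t \<in> ball 0 R"
      from ab(2)[OF subsetD[OF closure_subset R(3)[OF this]]]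
      show "Re (herm (-a) (F (z + t *s w) - 0)) \<le> - b" by (simp flip: inner_eq_Re_herm)
    qed
    then show False using ab(1)
      by (simp add: v_def inner_add_right flip: herm_smult inner_eq_Re_herm)
  qed
  have inG: "F z + \<zeta> *s v \<in> G" if \<zeta>: "norm \<zeta> < 1 / 2" for \<zeta>
  proof (cases "\<zeta> = 0")
    case True then show ?thesis using \<open>F z \<in> G\<close> by simp
  next
    case False
    \<comment> \<open>Passing from the closure to \<open>G\<close>: \<xi> is \<zeta> pushed out to
      modulus 1/2, and the open segment from the interior point \<open>F z\<close> to a point of the
      closure lies in the interior.\<close>
    define \<xi> where "\<xi> = \<zeta> / (2 * norm \<zeta>)"
    have "F z + \<xi> *s v \<in> closure G" using False by (intro cl) (simp add: \<xi>_def norm_divide norm_mult)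
    then have "open_segment (F z) (F z + \<xi> *s v) \<subseteq> interior G"
      using \<open>F z \<in> G\<close> G by (intro in_interior_closure_convex_segment) (auto simp: interior_open)
    moreover have "F z + \<zeta> *s v \<in> open_segment (F z) (F z + \<xi> *s v)"
    proof -
      have "F z + \<zeta> *s v = (1 - 2 * norm \<zeta>) *\<^sub>R F z + (2 * norm \<zeta>) *\<^sub>R (F z + \<xi> *s v)"
        using False by (simp add: algebra_simps scaleR_eq_vector_smult vector_smult_assoc \<xi>_def)
      moreover have "F z \<noteq> F z + \<xi> *s v" using False v0 by (auto simp: \<xi>_def)
      ultimately show ?thesis using \<zeta> False unfolding in_segment by (metis mult_2 mult_2_right nz norm_ge_zero \<open>norm \<zeta> < 1/2\<close> less_divide_eq_numeral1(1) mult.commute zero_less_norm_iff zero_less_mult_iff zero_less_numeral)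
    qed
    ultimately show ?thesis using G(1) by (auto simp: interior_open)
  qed
  define S where "S = {r. r > 0 \<and> (\<forall>\<zeta>\<in>ball 0 r. F z + \<zeta> *s (v /\<^sub>R norm v) \<in> G)}"
  have vs: "\<zeta> *s (v /\<^sub>R norm v) = (\<zeta> / norm v) *s v" for \<zeta>
    by (simp add: scaleR_eq_vector_smult vector_smult_assoc divide_inverse)
  have "norm v / 2 \<in> S"
    unfolding S_def vs using v0 by (auto intro!: inG simp: norm_divide field_simps)
  \<comment> \<open>\<open>directional_dist\<close> is a real \<open>Sup\<close>, which dominates
    the members of \<open>S\<close> only once they are bounded; boundedness of \<open>G\<close>
    provides this.\<close>
  moreover have "bdd_above S"
  proof -
    obtain B where B: "\<And>x. x \<in> G \<Longrightarrow> norm x \<le> B" using G(3) by (auto simp: bounded_iff)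
    have "r \<le> 4 * B" if "r \<in> S" for r
    proof -
      have "complex_of_real (r / 2) \<in> ball 0 r" using that by (simp add: S_def)
      then have "F z + complex_of_real (r / 2) *s (v /\<^sub>R norm v) \<in> G" using that unfolding S_def by blast
      then have "norm (F z + complex_of_real (r / 2) *s (v /\<^sub>R norm v)) \<le> B" by (rule B)
      moreover have "norm (complex_of_real (r / 2) *s (v /\<^sub>R norm v)) = r / 2"
        using that v0 by (simp add: norm_vector_smult S_def)
      ultimately show ?thesis using B[OF \<open>F z \<in> G\<close>]
        norm_triangle_ineq4[of "F z + complex_of_real (r / 2) *s (v /\<^sub>R norm v)" "F z"] by simp
    qed
    then show ?thesis by (rule bdd_aboveI)
  qed
  ultimately have "norm v / 2 \<le> Sup S" by (rule cSup_upper)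
  then show ?thesis by (simp add: directional_dist_def S_def v_def)
qed

text \<open>The Schwarz lemma on the complex line through \<open>z\<close> and \<open>y\<close>, one
  component at a time. Differences of values are below 2 M, and the dimension factor comes from
  bounding the Euclidean norm by the sum of the components.\<close>

lemma holomorphic_map_bounded_Lipschitz:
  fixes F :: "complex ^ 'n \<Rightarrow> complex ^ 'm"
  assumes hol: "holomorphic_map_on F D" and M: "\<And>z. z \<in> D \<Longrightarrow> norm (F z) < M"
    and r: "ball z r \<subseteq> D" and y: "dist z y < r"
  shows "norm (F y - F z) \<le> CARD('m) * (2 * M * dist z y / r)"
proof (cases "y = z")
  case False
  define h where "h = norm (y - z)"
  have h: "h > 0" "h < r" using False y by (auto simp: h_def dist_norm norm_minus_commute)
  define w where "w = complex_of_real (r / h) *s (y - z)"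
  have nw: "norm w = r"
    unfolding w_def norm_vector_smult h_def[symmetric] using h by (simp add: norm_divide)
  have inD: "z + t *s w \<in> D" if "t \<in> ball 0 1" for t
  proof -
    have "norm t * r < 1 * r" using that h by (intro mult_strict_right_mono) auto
    then show ?thesis using r by (intro subsetD[OF r]) (simp add: dist_norm norm_vector_smult nw)
  qed
  have "z \<in> D" using inD[of 0] by simp
  then have M0: "M > 0" using M[of z] norm_ge_zero[of "F z"] by linarith
  have yw: "y = z + complex_of_real (h / r) *s w" using h by (simp add: w_def vector_smult_assoc)
  have comp: "norm ((F y - F z) $ i) \<le> 2 * M * h / r" for i
  proof -
    define f where "f t = (F (z + t *s w) $ i - F z $ i) / (2 * M)" for t
    have "norm (f (complex_of_real (h / r))) \<le> norm (complex_of_real (h / r))"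
    proof (rule Schwarz_Lemma(1))
      show "f holomorphic_on ball 0 1"
        unfolding f_def using M0 by (intro holomorphic_intros holomorphic_slice[OF hol inD]) auto
      show "norm (f t) < 1" if "norm t < 1" for t
      proof -
        have "norm (F (z + t *s w) $ i) < M" "norm (F z $ i) < M"
          using M[OF inD[of t]] M[OF \<open>z \<in> D\<close>] Finite_Cartesian_Product.norm_nth_le[of "F (z + t *s w)" i] Finite_Cartesian_Product.norm_nth_le[of "F z" i] that
          by auto
        then have "norm (F (z + t *s w) $ i - F z $ i) < 2 * M"
          using norm_triangle_ineq4[of "F (z + t *s w) $ i" "F z $ i"] by linarith
        then show ?thesis using M0 by (simp add: f_def norm_divide)
      qed
    qed (use h in \<open>auto simp: f_def norm_divide\<close>)
    then show ?thesis using h M0 by (simp add: f_def norm_divide yw field_simps)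
  qed
  have "norm (F y - F z) \<le> (\<Sum>i\<in>UNIV. norm ((F y - F z) $ i))"
    unfolding norm_vec_def by (intro L2_set_le_sum) auto
  also have "\<dots> \<le> of_nat CARD('m) * (2 * M * h / r)" by (intro sum_bounded_above comp)
  finally show ?thesis by (simp add: h_def dist_norm norm_minus_commute)
qed simp

lemma log_type_deriv_estimate:
  fixes F :: "complex ^ 'n \<Rightarrow> complex ^ 'n"
  assumes hol: "holomorphic_map_on F D" and F\<Omega>: "F ` D \<subseteq> \<Omega>" and "bounded \<Omega>"
    and r0: "r0 > 0" "ball q r0 \<subseteq> \<O>" and log: "log_type_convex (\<O> \<inter> \<Omega>)"
  shows "\<exists>C>0. \<exists>\<nu>>0. \<forall>z r A v. r > 0 \<longrightarrow> ball z r \<subseteq> D \<longrightarrow> (F has_derivative (\<lambda>h. A *v h)) (at z) \<longrightarrow>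
      F z \<in> ball q (r0 / 2) \<longrightarrow> infdist (F z) (- (\<O> \<inter> \<Omega>)) \<noteq> 1 \<longrightarrow>
      norm (A *v v) \<le> C * norm v / (r * \<bar>ln (infdist (F z) (- (\<O> \<inter> \<Omega>)))\<bar> powr (1 + \<nu>))"
proof -
  define G where "G = \<O> \<inter> \<Omega>"
  obtain C \<nu> where C: "C > 0" "\<nu> > 0" and
    dd: "\<And>z v. z \<in> G \<Longrightarrow> v \<noteq> 0 \<Longrightarrow> infdist z (- G) \<noteq> 1 \<Longrightarrow>
        directional_dist G z v \<le> C / \<bar>ln (infdist z (- G))\<bar> powr (1 + \<nu>)"
    and G: "open G" "convex G" "bounded G"
    using log unfolding log_type_convex_def G_def by blast
  obtain M where "M > 0" and M: "\<And>x. x \<in> \<Omega> \<Longrightarrow> norm x < M"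
    using \<open>bounded \<Omega>\<close> unfolding bounded_pos_less by blast
  define n where "n = real CARD('n)"
  have n: "n > 0" by (simp add: n_def)
  \<comment> \<open>The disc of radius 2 \<theta> r has to stay in \<open>ball z r\<close>, whence
    1/2, and its image must move by at most r0 / 2, whence the second entry. Starting in
    \<open>ball q (r0 / 2)\<close>, the image then stays in \<open>ball q r0\<close>, and so in
    \<open>G\<close>.\<close>
  define \<theta> where "\<theta> = min (1 / 2) (r0 / (8 * n * M))"
  have \<theta>: "\<theta> > 0" "2 * \<theta> \<le> 1" "n * (2 * M * (2 * \<theta>)) \<le> r0 / 2"
    using r0 n \<open>M > 0\<close> by (auto simp: \<theta>_def min_def field_simps)
  have "norm (A *v v) \<le> (2 * C / \<theta>) * norm v / (r * \<bar>ln (infdist (F z) (- G))\<bar> powr (1 + \<nu>))"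
    if r: "r > 0" "ball z r \<subseteq> D" and A: "(F has_derivative (\<lambda>h. A *v h)) (at z)"
      and Fz: "F z \<in> ball q (r0 / 2)" and ne1: "infdist (F z) (- G) \<noteq> 1" for z r A v
  proof (cases "A *v v = 0")
    case False
    then have v: "norm v > 0" by auto
    define l where "l = \<theta> * r / norm v"
    have l: "l > 0" using \<theta> r v by (simp add: l_def)
    define w where "w = complex_of_real l *s v"
    have nw: "norm w = \<theta> * r" using v \<theta> r by (simp add: w_def l_def norm_vector_smult norm_divide norm_mult)
    have Aw: "A *v w = complex_of_real l *s (A *v v)" by (simp add: w_def vector_scalar_commute)
    have near: "dist z (z + t *s w) < 2 * \<theta> * r" if "t \<in> ball 0 2" for t
    proof -
      have "norm t * (\<theta> * r) < 2 * (\<theta> * r)" using that \<theta> r by (intro mult_strict_right_mono) auto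
      then show ?thesis by (simp add: dist_norm norm_vector_smult nw)
    qed
    have near': "dist z (z + t *s w) < r" if "t \<in> ball 0 2" for t
    proof -
      have "2 * \<theta> * r \<le> 1 * r" using \<theta> r by (intro mult_right_mono) auto
      then show ?thesis using near[OF that] by simp
    qed
    have inD: "z + t *s w \<in> D" if "t \<in> ball 0 2" for t using near'[OF that] r by auto
    have inG: "F (z + t *s w) \<in> G" if t: "t \<in> ball 0 2" for t
    proof -
      have "norm (F (z + t *s w) - F z) \<le> n * (2 * M * dist z (z + t *s w) / r)"
        unfolding n_def using F\<Omega> M by (intro holomorphic_map_bounded_Lipschitz[OF hol _ r(2) near'[OF t]]) auto
      also have "\<dots> \<le> n * (2 * M * (2 * \<theta> * r) / r)"
        using n \<open>M > 0\<close> r near[OF t] by (intro mult_left_mono divide_right_mono) auto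
      also have "\<dots> \<le> r0 / 2" using \<theta>(3) r by simp
      finally have "dist (F z) (F (z + t *s w)) \<le> r0 / 2" by (simp add: dist_norm norm_minus_commute)
      then have "F (z + t *s w) \<in> ball q r0" using Fz dist_triangle[of q "F (z + t *s w)" "F z"] by simp
      then show ?thesis using r0 F\<Omega> inD[OF t] by (auto simp: G_def)
    qed
    have Aw0: "A *v w \<noteq> 0" using False l unfolding Aw by simp
    have "F z \<in> G" using inG[of 0] by simp
    have "norm (A *v w) / 2 \<le> directional_dist G (F z) (A *v w)"
      by (rule directional_dist_ge[OF hol A G _ inD inG Aw0]) auto
    also have "\<dots> \<le> C / \<bar>ln (infdist (F z) (- G))\<bar> powr (1 + \<nu>)"
      by (rule dd[OF \<open>F z \<in> G\<close> Aw0 ne1])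
    finally have "l * norm (A *v v) / 2 \<le> C / \<bar>ln (infdist (F z) (- G))\<bar> powr (1 + \<nu>)"
      using l by (simp add: Aw norm_vector_smult)
    then have "norm (A *v v) \<le> 2 * (C / \<bar>ln (infdist (F z) (- G))\<bar> powr (1 + \<nu>)) / l"
      using l by (subst pos_le_divide_eq) (auto simp: mult.commute)
    also have "\<dots> = (2 * C / \<theta>) * norm v / (r * \<bar>ln (infdist (F z) (- G))\<bar> powr (1 + \<nu>))"
      using v \<theta> r by (simp add: l_def)
    finally show ?thesis .
  qed (use C \<theta> r in auto)
  then show ?thesis unfolding G_def using C \<theta>
    by (intro exI[of _ "2 * C / \<theta>"] conjI exI[of _ \<nu>]) auto
qed

section \<open>The boundary of \<open>D\<close> as a Lipschitz graph\<close>

lemma herm_matrix_vector: "herm (A *v x) y = herm x ((\<chi> i j. cnj (A $ j $ i)) *v y)" for A :: "complex ^ 'n ^ 'n"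
proof -
  have "herm (A *v x) y = (\<Sum>i\<in>UNIV. \<Sum>j\<in>UNIV. cnj (A $ i $ j) * cnj (x $ j) * y $ i)"
    by (simp add: herm_def matrix_vector_mult_def sum_distrib_right)
  also have "\<dots> = (\<Sum>j\<in>UNIV. \<Sum>i\<in>UNIV. cnj (A $ i $ j) * cnj (x $ j) * y $ i)" by (rule sum.swap)
  also have "\<dots> = herm x ((\<chi> i j. cnj (A $ j $ i)) *v y)"
    by (simp add: herm_def matrix_vector_mult_def sum_distrib_left mult.commute mult.left_commute)
  finally show ?thesis .
qed

lemma unitary_mapD:
  assumes "unitary_map T"
  shows "linear T" "norm (T x) = norm x" "surj T"
proof -
  obtain A where A: "(\<chi> i j. cnj (A $ j $ i)) ** A = mat 1" "T = (\<lambda>z. A *v z)"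
    using assms unfolding unitary_map_def by blast
  show "linear T"
    unfolding A(2) by (rule linearI) (simp_all add: matrix_vector_right_distrib scaleR_eq_vector_smult vector_scalar_commute)
  have "herm (T x) (T x) = herm x x"
    unfolding A(2) herm_matrix_vector matrix_vector_mul_assoc A(1) by simp
  then have "(norm (T x))\<^sup>2 = (norm x)\<^sup>2" by (metis herm_self of_real_eq_iff)
  then show "norm (T x) = norm x" by simp
  have "A ** (\<chi> i j. cnj (A $ j $ i)) = mat 1" using A(1) by (simp add: matrix_left_right_inverse)
  then show "surj T" unfolding A(2) using matrix_right_invertible_surjective by blast
qed

text \<open>Continuity at the origin bounds the gradient on a smaller domain, and that domain is
  convex, so the mean value inequality applies.\<close>

lemma graph_function_Lipschitz:
  fixes \<phi> :: "(complex ^ 'n) \<times> real \<Rightarrow> real"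
  assumes "has_gradient_on k r \<phi> g" "continuous_on (graph_domain k r) g" "r > 0"
  shows "\<exists>s>0. s \<le> r \<and> (\<exists>L\<ge>0. \<forall>x\<in>graph_domain k s. \<forall>y\<in>graph_domain k s. \<bar>\<phi> x - \<phi> y\<bar> \<le> L * norm (x - y))"
proof -
  have 0: "(0, 0) \<in> graph_domain k r" using assms(3) by (simp add: graph_domain_def)
  obtain \<delta> where \<delta>: "\<delta> > 0" "\<And>x. x \<in> graph_domain k r \<Longrightarrow> dist x (0, 0) < \<delta> \<Longrightarrow> dist (g x) (g (0, 0)) < 1"
    using assms(2) 0 unfolding continuous_on_iff by (metis zero_less_one)
  define s where "s = min r (\<delta> / 2)"
  have s: "s > 0" "s \<le> r" "s \<le> \<delta> / 2" using assms(3) \<delta> by (auto simp: s_def)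
  define S where "S = graph_domain k s"
  define L where "L = norm (g (0, 0)) + 1"
  have Sr: "S \<subseteq> graph_domain k r" using s by (auto simp: S_def graph_domain_def)
  have "convex S"
  proof -
    have "S = ({w. w $ k = 0} \<inter> ball 0 s) \<times> {-s<..<s}"
      by (auto simp: S_def graph_domain_def dist_norm abs_less_iff)
    moreover have "convex {w :: complex ^ 'n. w $ k = 0}" by (auto simp: convex_def)
    ultimately show ?thesis by (simp add: convex_Times convex_Int)
  qed
  have gL: "norm (g x) \<le> L" if "x \<in> S" for x
  proof -
    obtain w t where x: "x = (w, t)" by fastforce
    have "norm x \<le> norm w + norm t" unfolding x by (rule norm_Pair_le)
    then have "dist x (0, 0) < \<delta>" using that s unfolding x S_def by (simp add: graph_domain_def dist_norm flip: zero_prod_def)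
    then have "dist (g x) (g (0, 0)) < 1" using that Sr by (intro \<delta>(2)) auto
    then show ?thesis using norm_triangle_ineq2[of "g x" "g (0, 0)"] by (simp add: L_def dist_norm)
  qed
  have "norm (\<phi> x - \<phi> y) \<le> L * norm (x - y)" if "x \<in> S" "y \<in> S" for x y
  proof (rule differentiable_bound[OF \<open>convex S\<close> _ _ that(1,2)])
    fix x assume x: "x \<in> S"
    then show "(\<phi> has_derivative (\<lambda>h. g x \<bullet> h)) (at x within S)"
      using assms(1) Sr unfolding has_gradient_on_def by (meson has_derivative_subset subsetD)
    show "onorm (\<lambda>h. g x \<bullet> h) \<le> L"
    proof (rule onorm_le)
      fix h
      have "\<bar>g x \<bullet> h\<bar> \<le> norm (g x) * norm h" by (rule Cauchy_Schwarz_ineq2)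
      also have "\<dots> \<le> L * norm h" using gL[OF x] by (intro mult_right_mono) auto
      finally show "norm (g x \<bullet> h) \<le> L * norm h" by simp
    qed
  qed
  then show ?thesis
    using s by (intro exI[of _ s] conjI exI[of _ L]) (auto simp: S_def L_def)
qed

lemma first_coords_diff: "first_coords k (x - y) = first_coords k x - first_coords k y"
  by (simp add: first_coords_def vec_eq_iff)

lemma norm_first_coords_le: "norm (first_coords k x) \<le> norm x" for x :: "complex ^ 'n"
  unfolding norm_vec_def first_coords_def by (intro L2_set_mono) auto

text \<open>\<open>H\<close> is the vertical height above the graph in the unitary coordinates, and
  \<open>e\<close> is the vertical direction, that is, the preimage of i times the last basis
  vector.\<close>

lemma C1_Dini_boundary_local_graph:
  fixes D :: "(complex ^ 'n) set"
  assumes "p \<in> frontier D" "p \<in> U" "C1_Dini_boundary D U"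
  shows "\<exists>s>0. \<exists>\<Lambda>\<ge>1. \<exists>e H. ball p s \<subseteq> U \<and> norm e = 1 \<and>
     (\<forall>x\<in>ball p s. \<forall>y\<in>ball p s. \<bar>H x - H y\<bar> \<le> \<Lambda> * norm (x - y)) \<and>
     (\<forall>x t. x \<in> ball p s \<longrightarrow> x + t *\<^sub>R e \<in> ball p s \<longrightarrow> H (x + t *\<^sub>R e) = H x + t) \<and>
     (\<forall>x\<in>ball p s \<inter> D. H x > 0) \<and> (\<forall>x\<in>ball p s. x \<in> frontier D \<longleftrightarrow> H x = (0::real))"
proof -
  obtain \<omega> k where charts: "\<forall>\<xi>\<in>frontier D \<inter> U. \<exists>N T r \<phi> g.
          open N \<and> \<xi> \<in> N \<and> N \<subseteq> U \<and> unitary_map T \<and> r > 0 \<and>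
          has_gradient_on k r \<phi> g \<and> continuous_on (graph_domain k r) g \<and>
          (\<forall>x\<in>graph_domain k r. \<forall>y\<in>graph_domain k r. norm (g x - g y) \<le> \<omega> (norm (x - y))) \<and>
          (\<lambda>z. T (z - \<xi>)) ` (N \<inter> D) \<subseteq>
            {Z. Im (Z $ k) > \<phi> (first_coords k Z, Re (Z $ k)) \<and>
                norm (first_coords k Z) < r \<and> \<bar>Re (Z $ k)\<bar> < r} \<and>
          (\<lambda>z. T (z - \<xi>)) ` (N \<inter> frontier D) =
            {Z. Im (Z $ k) = \<phi> (first_coords k Z, Re (Z $ k)) \<and>
                norm (first_coords k Z) < r \<and> \<bar>Re (Z $ k)\<bar> < r}"
    using assms(3)[unfolded C1_Dini_boundary_def] by (elim exE conjE) (rule that)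
  have pU: "p \<in> frontier D \<inter> U" using assms(1,2) by blast
  obtain N T r \<phi> g where N: "open N" "p \<in> N" "N \<subseteq> U" and T: "unitary_map T" and "r > 0" and
    grad: "has_gradient_on k r \<phi> g" "continuous_on (graph_domain k r) g" and
    inside: "(\<lambda>z. T (z - p)) ` (N \<inter> D) \<subseteq>
            {Z. Im (Z $ k) > \<phi> (first_coords k Z, Re (Z $ k)) \<and>
                norm (first_coords k Z) < r \<and> \<bar>Re (Z $ k)\<bar> < r}" and
    bdry: "(\<lambda>z. T (z - p)) ` (N \<inter> frontier D) =
            {Z. Im (Z $ k) = \<phi> (first_coords k Z, Re (Z $ k)) \<and>
                norm (first_coords k Z) < r \<and> \<bar>Re (Z $ k)\<bar> < r}"
    using bspec[OF charts pU] by (elim exE conjE) (rule that)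
  note linT = unitary_mapD(1)[OF T] and normT = unitary_mapD(2)[OF T]
  obtain s0 L where s0: "s0 > 0" "s0 \<le> r" "L \<ge> 0" and
    L: "\<And>x y. x \<in> graph_domain k s0 \<Longrightarrow> y \<in> graph_domain k s0 \<Longrightarrow> \<bar>\<phi> x - \<phi> y\<bar> \<le> L * norm (x - y)"
    using graph_function_Lipschitz[OF grad \<open>r > 0\<close>] by blast
  obtain s1 where s1: "s1 > 0" "ball p s1 \<subseteq> N" using N(1,2) open_contains_ball by blast
  define s where "s = min s0 s1"
  have s: "s > 0" "s \<le> s0" "ball p s \<subseteq> N" using s0 s1 by (auto simp: s_def)
  define \<pi> where "\<pi> Z = (first_coords k Z, Re (Z $ k))" for Z :: "complex ^ 'n"
  define H where "H z = Im (T (z - p) $ k) - \<phi> (\<pi> (T (z - p)))" for z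
  have \<pi>_diff: "\<pi> Z - \<pi> W = \<pi> (Z - W)" for Z W by (simp add: \<pi>_def first_coords_diff)
  have Re_le: "\<bar>Re (Z $ k)\<bar> \<le> norm Z" and Im_le: "\<bar>Im (Z $ k)\<bar> \<le> norm Z" for Z :: "complex ^ 'n"
    using abs_Re_le_cmod[of "Z $ k"] abs_Im_le_cmod[of "Z $ k"] Finite_Cartesian_Product.norm_nth_le[of Z k] by linarith+
  have \<pi>_le: "norm (\<pi> Z) \<le> 2 * norm Z" for Z
    using norm_Pair_le[of "first_coords k Z" "Re (Z $ k)"] norm_first_coords_le[of k Z] Re_le[of Z] by (simp add: \<pi>_def)
  have \<pi>_dom: "\<pi> (T (z - p)) \<in> graph_domain k s0" if "z \<in> ball p s" for z
  proof -
    have "norm (T (z - p)) < s0" using that s by (simp add: normT dist_norm norm_minus_commute)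
    then show ?thesis
      using norm_first_coords_le[of k "T (z - p)"] Re_le[of "T (z - p)"]
      by (simp add: \<pi>_def graph_domain_def) (simp add: first_coords_def)
  qed
  have in_r: "norm (first_coords k (T (z - p))) < r" "\<bar>Re (T (z - p) $ k)\<bar> < r" if "z \<in> ball p s" for z
    using \<pi>_dom[OF that] s0 by (auto simp: \<pi>_def graph_domain_def)
  have Tdiff: "T (x - p) - T (y - p) = T (x - y)" for x y
    by (simp flip: linear_diff[OF linT])
  have norm_Tdiff: "norm (T (x - p) - T (y - p)) = norm (x - y)" for x y
    unfolding Tdiff by (rule normT)
  have Lip: "\<bar>H x - H y\<bar> \<le> (1 + 2 * L) * norm (x - y)" if "x \<in> ball p s" "y \<in> ball p s" for x y
  proof -
    have "\<bar>\<phi> (\<pi> (T (x - p))) - \<phi> (\<pi> (T (y - p)))\<bar> \<le> L * norm (\<pi> (T (x - y)))"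
      using L[OF \<pi>_dom[OF that(1)] \<pi>_dom[OF that(2)]] by (simp only: \<pi>_diff Tdiff)
    also have "\<dots> \<le> L * (2 * norm (x - y))" using \<pi>_le[of "T (x - y)"] s0 by (intro mult_left_mono) (simp_all add: normT)
    finally have 1: "\<bar>\<phi> (\<pi> (T (x - p))) - \<phi> (\<pi> (T (y - p)))\<bar> \<le> L * (2 * norm (x - y))" .
    have "\<bar>Im (T (x - p) $ k) - Im (T (y - p) $ k)\<bar> \<le> norm (x - y)"
      using Im_le[of "T (x - p) - T (y - p)"] by (simp add: norm_Tdiff)
    then have "\<bar>H x - H y\<bar> \<le> norm (x - y) + L * (2 * norm (x - y))" using 1 unfolding H_def by linarith
    then show ?thesis by (simp add: algebra_simps)
  qed
  obtain e where e: "T e = axis k \<i>" using unitary_mapD(3)[OF T] by (metis surjD)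
  have ne: "norm e = 1" using normT[of e] by (simp add: e)
  have trans: "H (x + t *\<^sub>R e) = H x + t" for x t
  proof -
    have "x + t *\<^sub>R e - p = (x - p) + t *\<^sub>R e" by simp
    then have "T (x + t *\<^sub>R e - p) = T (x - p) + t *\<^sub>R axis k \<i>"
      by (simp only: linear_add[OF linT] linear_scale[OF linT] e)
    moreover have "\<pi> (T (x - p) + t *\<^sub>R axis k \<i>) = \<pi> (T (x - p))"
      by (auto simp: \<pi>_def first_coords_def vec_eq_iff axis_def)
    ultimately show ?thesis by (simp add: H_def)
  qed
  have pos: "H x > 0" if "x \<in> ball p s \<inter> D" for x
  proof -
    have "T (x - p) \<in> (\<lambda>z. T (z - p)) ` (N \<inter> D)" using that s by blast
    from subsetD[OF inside this] show ?thesis by (simp add: H_def \<pi>_def)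
  qed
  have zero: "x \<in> frontier D \<longleftrightarrow> H x = 0" if x: "x \<in> ball p s" for x
  proof
    assume "x \<in> frontier D"
    then have "T (x - p) \<in> (\<lambda>z. T (z - p)) ` (N \<inter> frontier D)" using x s by blast
    then show "H x = 0" unfolding bdry by (simp add: H_def \<pi>_def)
  next
    assume "H x = 0"
    then have "T (x - p) \<in> (\<lambda>z. T (z - p)) ` (N \<inter> frontier D)"
      unfolding bdry using in_r[OF x] by (simp add: H_def \<pi>_def)
    then obtain y where y: "y \<in> frontier D" "T (x - p) = T (y - p)" by blast
    have "norm (x - y) = 0" using Tdiff[of x y] normT[of "x - y"] y(2) by simp
    then show "x \<in> frontier D" using y(1) by simp
  qed
  have "ball p s \<subseteq> U" using s N by blast
  moreover have "1 + 2 * L \<ge> 1" using s0 by simp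
  ultimately show ?thesis
    using s(1) ne Lip trans pos zero
    by (intro exI[of _ s] conjI exI[of _ "1 + 2 * L"] exI[of _ e] exI[of _ H]) auto
qed

text \<open>The charts place \<open>D\<close> above the graph but do not say that every point above
  it is in \<open>D\<close>. A point above the graph outside \<open>D\<close> could be joined,
  staying above the graph, to a point of \<open>D\<close>; the path would meet the frontier, where
  \<open>H\<close> vanishes.\<close>

lemma C1_Dini_boundary_local_defining_function:
  fixes D :: "(complex ^ 'n) set"
  assumes "open D" "p \<in> frontier D" "p \<in> U" "C1_Dini_boundary D U"
  obtains s \<Lambda> e H where "s > 0" "\<Lambda> \<ge> 1" "ball p s \<subseteq> U" "norm e = 1"
     "\<And>x y. x \<in> ball p s \<Longrightarrow> y \<in> ball p s \<Longrightarrow> \<bar>H x - H y\<bar> \<le> \<Lambda> * norm (x - y)"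
     "\<And>x t. x \<in> ball p s \<Longrightarrow> x + t *\<^sub>R e \<in> ball p s \<Longrightarrow> H (x + t *\<^sub>R e) = H x + t"
     "\<And>x. x \<in> ball p s \<Longrightarrow> x \<in> D \<longleftrightarrow> H x > 0"
     "\<And>x. x \<in> ball p s \<Longrightarrow> x \<in> frontier D \<longleftrightarrow> H x = (0::real)"
proof -
  obtain s \<Lambda> e H where s: "s > 0" and \<Lambda>: "\<Lambda> \<ge> 1" and U: "ball p s \<subseteq> U" and e: "norm e = 1" and
    Lip0: "\<forall>x\<in>ball p s. \<forall>y\<in>ball p s. \<bar>H x - H y\<bar> \<le> \<Lambda> * norm (x - y)" and
    trans0: "\<forall>x t. x \<in> ball p s \<longrightarrow> x + t *\<^sub>R e \<in> ball p s \<longrightarrow> H (x + t *\<^sub>R e) = H x + t" and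
    pos0: "\<forall>x\<in>ball p s \<inter> D. H x > 0" and
    zero0: "\<forall>x\<in>ball p s. x \<in> frontier D \<longleftrightarrow> H x = (0::real)"
    using C1_Dini_boundary_local_graph[OF assms(2-4)] by (elim exE conjE) (rule that)
  note Lip = Lip0[rule_format] and trans = trans0[rule_format] and zero = zero0[rule_format]
  have pos: "H x > 0" if "x \<in> ball p s" "x \<in> D" for x using pos0 that by blast
  \<comment> \<open>With \<tau> = 2 \<Lambda> s' and s' + \<tau> = s, points of the small ball
    lifted by \<tau> remain in \<open>ball p s\<close>. Along the lifted segment \<open>H\<close>
    stays positive, as it varies by less than \<Lambda> (2 s') = \<tau>.\<close>
  define s' where "s' = s / (1 + 2 * \<Lambda>)"
  have s': "s' > 0" "s' * (1 + 2 * \<Lambda>) = s" using s \<Lambda> by (auto simp: s'_def)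
  define \<tau> where "\<tau> = 2 * \<Lambda> * s'"
  have \<tau>: "\<tau> > 0" "s' + \<tau> = s" using s' \<Lambda> by (auto simp: \<tau>_def algebra_simps)
  have sub: "ball p s' \<subseteq> ball p s" using \<tau> by auto
  have shift: "x + t *\<^sub>R e \<in> ball p s" if "x \<in> ball p s'" "0 \<le> t" "t \<le> \<tau>" for x t
  proof -
    have "dist p (x + t *\<^sub>R e) \<le> dist p x + dist x (x + t *\<^sub>R e)" by (rule dist_triangle)
    then show ?thesis using that e \<tau> by (simp add: dist_norm)
  qed
  obtain z1 where z1: "z1 \<in> D" "z1 \<in> ball p s'"
    using assms(2) s'(1) unfolding frontier_straddle by (metis mem_ball)
  have "z \<in> D" if z: "z \<in> ball p s'" "H z > 0" for z
  proof (rule ccontr)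
    assume "z \<notin> D"
    define up where "up x = closed_segment x (x + \<tau> *\<^sub>R e)" for x
    define C where "C = up z \<union> closed_segment (z + \<tau> *\<^sub>R e) (z1 + \<tau> *\<^sub>R e) \<union> up z1"
    have "connected C"
      unfolding C_def up_def by (intro connected_Un connected_segment) auto
    moreover have "z1 \<in> C \<inter> D" "z \<in> C - D" using z1 \<open>z \<notin> D\<close> by (auto simp: C_def up_def)
    ultimately have "C \<inter> frontier D \<noteq> {}" by (intro connected_Int_frontier) auto
    then obtain y where y: "y \<in> C" "y \<in> frontier D" by blast
    have vert: "y \<in> ball p s \<and> H y > 0" if yup: "y \<in> up x" "x \<in> ball p s'" "H x > 0" for x y
    proof -
      obtain u where u: "0 \<le> u" "u \<le> 1" "y = (1 - u) *\<^sub>R x + u *\<^sub>R (x + \<tau> *\<^sub>R e)"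
        using yup by (auto simp: up_def in_segment)
      have yx: "y = x + (u * \<tau>) *\<^sub>R e" unfolding u(3) by (simp add: algebra_simps)
      have "u * \<tau> \<le> \<tau>" "0 \<le> u * \<tau>" using u \<tau> by (auto simp: mult_left_le_one_le)
      then have "y \<in> ball p s" unfolding yx using shift[OF that(2)] by blast
      then show ?thesis using trans[of x "u * \<tau>"] that(2,3) sub u \<tau> unfolding yx
        by (metis add_pos_nonneg \<open>0 \<le> u * \<tau>\<close> subsetD)
    qed
    have "y \<in> ball p s \<and> H y > 0"
    proof (cases "y \<in> up z \<or> y \<in> up z1")
      case True
      then show ?thesis using vert z z1 pos[of z1] sub by blast
    next
      case False
      then obtain u where u: "0 \<le> u" "u \<le> 1" "y = (1 - u) *\<^sub>R (z + \<tau> *\<^sub>R e) + u *\<^sub>R (z1 + \<tau> *\<^sub>R e)"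
        using y(1) by (auto simp: C_def in_segment)
      define x where "x = (1 - u) *\<^sub>R z + u *\<^sub>R z1"
      have yx: "y = x + \<tau> *\<^sub>R e" unfolding u(3) x_def by (simp add: algebra_simps)
      have x: "x \<in> ball p s'" unfolding x_def
        using convexD_alt[OF convex_ball z(1) z1(2)] u by blast
      have "dist x z < 2 * s'" using x z(1) dist_triangle2[of x z p] by (simp add: dist_commute)
      then have "\<Lambda> * norm (z - x) \<le> \<tau>" using \<Lambda> by (simp add: \<tau>_def dist_norm norm_minus_commute)
      then have "H x + \<tau> > 0" using Lip[of z x] z x sub by (smt (verit, ccfv_SIG) subsetD)
      then show ?thesis using trans[of x \<tau>] shift[OF x, of \<tau>] x sub \<tau> unfolding yx by auto
    qed
    then show False using zero y(2) by auto
  qed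
  then have char: "z \<in> D \<longleftrightarrow> H z > 0" if "z \<in> ball p s'" for z
    using that pos sub by blast
  show ?thesis
  proof (rule that[where H = H, OF s'(1) \<Lambda> _ e])
    show "ball p s' \<subseteq> U" using sub U by blast
    show "\<bar>H x - H y\<bar> \<le> \<Lambda> * norm (x - y)" if "x \<in> ball p s'" "y \<in> ball p s'" for x y
      by (rule Lip) (use that sub in \<open>simp_all only: subsetD\<close>)
    show "H (x + t *\<^sub>R e) = H x + t" if "x \<in> ball p s'" "x + t *\<^sub>R e \<in> ball p s'" for x t
      by (rule trans) (use that sub in \<open>simp_all only: subsetD\<close>)
    show "x \<in> frontier D \<longleftrightarrow> H x = 0" if "x \<in> ball p s'" for x
      by (rule zero) (use that sub in \<open>simp only: subsetD\<close>)
  qed (rule char)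
qed

section \<open>Integrating the derivative bound along paths\<close>

text \<open>A first-exit argument: up to the first time \<open>f\<close> reaches distance
  \<open>r\<close> from \<open>q\<close> the derivative bound is in force, and by
  \<open>start\<close> the resulting estimate keeps \<open>f\<close> strictly inside at that time
  too.\<close>

lemma bootstrap_bound:
  fixes f :: "real \<Rightarrow> 'a :: real_normed_vector" and B :: "real \<Rightarrow> real"
  assumes "a < b" "continuous_on {a..b} f" "continuous_on {a..b} B"
    and f': "\<And>t. a < t \<Longrightarrow> t < b \<Longrightarrow> (f has_vector_derivative f' t) (at t)"
    and B': "\<And>t. a < t \<Longrightarrow> t < b \<Longrightarrow> (B has_vector_derivative B' t) (at t)"
    and B'_nonneg: "\<And>t. a < t \<Longrightarrow> t < b \<Longrightarrow> 0 \<le> B' t"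
    and le: "\<And>t. a < t \<Longrightarrow> t < b \<Longrightarrow> norm (f t - q) < r \<Longrightarrow> norm (f' t) \<le> B' t"
    and start: "norm (f a - q) + (B b - B a) < r"
  shows "norm (f b - f a) \<le> B b - B a"
proof -
  have mono: "B t \<le> B b" if "t \<in> {a..b}" for t
  proof (cases "t = b")
    case False
    \<comment> \<open>Monotonicity of \<open>B\<close>, read off by comparing it with the zero
      function.\<close>
    have "norm (0 - (0::real)) \<le> B b - B t"
      using that False assms(1)
      by (intro differentiable_bound_general[where f = "\<lambda>_. 0" and f' = "\<lambda>_. 0" and \<phi>' = B'])
        (auto intro: B' B'_nonneg continuous_on_subset[OF assms(3)])
    then show ?thesis by simp
  qed simp
  have step: "norm (f t - f a) \<le> B t - B a"
    if t: "a \<le> t" "t \<le> b" and near: "\<And>x. a < x \<Longrightarrow> x < t \<Longrightarrow> norm (f x - q) < r" for t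
  proof (cases "t = a")
    case False
    then show ?thesis using t near
      by (intro differentiable_bound_general[where f' = f' and \<phi>' = B'])
        (auto intro: f' B' le continuous_on_subset[OF assms(2)] continuous_on_subset[OF assms(3)])
  qed simp
  \<comment> \<open>The exit times. \<open>S\<close> is closed, so its infimum is attained and is
    the first exit; before it \<open>step\<close> is applicable.\<close>
  define S where "S = {t \<in> {a..b}. r \<le> norm (f t - q)}"
  have "S = {}"
  proof (rule ccontr)
    assume "S \<noteq> {}"
    have "closed S"
      unfolding S_def using assms(2) by (intro continuous_closed_preimage_constant continuous_on_closed_Collect_le continuous_intros) auto
    moreover have bb: "bdd_below S" by (auto simp: S_def intro: bdd_belowI[of _ a])
    ultimately have "Inf S \<in> S" using \<open>S \<noteq> {}\<close> by (intro closed_contains_Inf)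
    have t: "a \<le> Inf S" "Inf S \<le> b" "r \<le> norm (f (Inf S) - q)" using \<open>Inf S \<in> S\<close> by (auto simp: S_def)
    have "norm (f (Inf S) - f a) \<le> B (Inf S) - B a"
    proof (rule step[OF t(1,2)])
      fix x assume "a < x" "x < Inf S"
      then have "x \<notin> S" using cInf_lower[OF _ bb] by force
      then show "norm (f x - q) < r" using \<open>a < x\<close> \<open>x < Inf S\<close> t(2) by (auto simp: S_def)
    qed
    then show False
      using t start mono[of "Inf S"] norm_triangle_ineq[of "f (Inf S) - f a" "f a - q"] by simp
  qed
  then have "norm (f x - q) < r" if "a < x" "x < b" for x
  proof -
    have "x \<notin> S" using \<open>S = {}\<close> by simp
    then show ?thesis using that by (auto simp: S_def)
  qed
  then show ?thesis using assms(1) by (intro step) auto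
qed

lemma bootstrap_segment:
  fixes F :: "complex ^ 'n \<Rightarrow> complex ^ 'm" and B :: "real \<Rightarrow> real"
  assumes hol: "holomorphic_map_on F D" and L: "L > 0" and inD: "\<And>t. 0 \<le> t \<Longrightarrow> t \<le> L \<Longrightarrow> x + t *\<^sub>R v \<in> D"
    and B: "\<And>t. 0 \<le> t \<Longrightarrow> t \<le> L \<Longrightarrow> (B has_real_derivative B' t) (at t)"
    and B'_nonneg: "\<And>t. 0 \<le> t \<Longrightarrow> t \<le> L \<Longrightarrow> 0 \<le> B' t"
    and le: "\<And>t A. 0 \<le> t \<Longrightarrow> t \<le> L \<Longrightarrow> (F has_derivative (\<lambda>h. A *v h)) (at (x + t *\<^sub>R v)) \<Longrightarrow>
        F (x + t *\<^sub>R v) \<in> ball q r \<Longrightarrow> norm (A *v v) \<le> B' t"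
    and start: "norm (F x - q) + (B L - B 0) < r"
  shows "norm (F (x + L *\<^sub>R v) - F x) \<le> B L - B 0"
proof -
  have "\<forall>t\<in>{0..L}. \<exists>A :: complex ^ 'n ^ 'm. (F has_derivative (\<lambda>h. A *v h)) (at (x + t *\<^sub>R v))"
    using hol inD unfolding holomorphic_map_on_def by auto
  then obtain A where A: "\<And>t. 0 \<le> t \<Longrightarrow> t \<le> L \<Longrightarrow> (F has_derivative (\<lambda>h. A t *v h)) (at (x + t *\<^sub>R v))"
    by (metis atLeastAtMost_iff)
  have der: "((\<lambda>t. F (x + t *\<^sub>R v)) has_vector_derivative A t *v v) (at t)" if "0 \<le> t" "t \<le> L" for t
  proof -
    have "((\<lambda>t. x + t *\<^sub>R v) has_derivative (\<lambda>t. t *\<^sub>R v)) (at t)" by (auto intro!: derivative_eq_intros)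
    from diff_chain_at[OF this A[OF that]]
    have "((\<lambda>t. F (x + t *\<^sub>R v)) has_derivative (\<lambda>s. A t *v (s *\<^sub>R v))) (at t)" by (simp add: o_def)
    moreover have "A t *v (s *\<^sub>R v) = s *\<^sub>R (A t *v v)" for s
      by (simp add: scaleR_eq_vector_smult vector_scalar_commute)
    ultimately show ?thesis by (simp add: has_vector_derivative_def)
  qed
  have "norm (F (x + L *\<^sub>R v) - F (x + 0 *\<^sub>R v)) \<le> B L - B 0"
  proof (rule bootstrap_bound[where f = "\<lambda>t. F (x + t *\<^sub>R v)" and q = q and r = r and f' = "\<lambda>t. A t *v v" and B' = B', OF L])
    show "continuous_on {0..L} (\<lambda>t. F (x + t *\<^sub>R v))"
      using der by (intro continuous_at_imp_continuous_on ballI) (auto intro: has_vector_derivative_continuous)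
    show "continuous_on {0..L} B"
      using B by (intro continuous_at_imp_continuous_on ballI) (auto intro: DERIV_isCont)
  qed (use der B B'_nonneg le[OF _ _ A] start in \<open>auto simp: dist_norm norm_minus_commute has_real_derivative_iff_has_vector_derivative\<close>)
  then show ?thesis by simp
qed

text \<open>
  The points are joined by moving up to height \<open>\<tau> = 4 \<Lambda> \<delta>\<close>, across, and down again; the derivative bound
  integrates to \<open>osc\<close> along this path. It is available only while \<open>F\<close> stays in \<open>ball q r\<close>, which
  \<open>start\<close> and \<open>bootstrap_bound\<close> ensure.
\<close>

lemma crossing_estimate:
  fixes F :: "complex ^ 'n \<Rightarrow> complex ^ 'm" and H :: "complex ^ 'n \<Rightarrow> real"
  assumes hol: "holomorphic_map_on F D" and \<Lambda>: "\<Lambda> \<ge> 1" and e: "norm e = 1"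
    and Lip: "\<And>x y. x \<in> ball p s \<Longrightarrow> y \<in> ball p s \<Longrightarrow> \<bar>H x - H y\<bar> \<le> \<Lambda> * norm (x - y)"
    and trans: "\<And>x t. x \<in> ball p s \<Longrightarrow> x + t *\<^sub>R e \<in> ball p s \<Longrightarrow> H (x + t *\<^sub>R e) = H x + t"
    and inside: "\<And>x. x \<in> ball p s \<Longrightarrow> x \<in> D \<longleftrightarrow> H x > 0"
    and K: "K > 0" and \<nu>: "\<nu> > 0"
    and est: "\<And>z A v. z \<in> ball p s \<Longrightarrow> 0 < H z \<Longrightarrow> H z < h0 \<Longrightarrow> (F has_derivative (\<lambda>h. A *v h)) (at z) \<Longrightarrow>
        F z \<in> ball q r \<Longrightarrow> norm (A *v v) \<le> K * norm v / (H z * (- ln (H z)) powr (1 + \<nu>))"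
    and \<delta>: "\<delta> > 0" and p': "ball p' ((1 + 4 * \<Lambda>) * \<delta>) \<subseteq> ball p s" "H p' = 0"
    and X: "X = \<Lambda> * ((1 + 4 * \<Lambda>) * \<delta>)" "X \<le> h0" "X < 1"
    and z: "z1 \<in> D \<inter> ball p' \<delta>" "z2 \<in> D \<inter> ball p' \<delta>"
  defines "osc \<equiv> 2 * (K / \<nu> * (- ln X) powr (- \<nu>)) + K * (- ln X) powr (- (1 + \<nu>))"
  assumes start: "norm (F z1 - q) + osc < r"
  shows "norm (F z2 - F z1) \<le> osc"
proof -
  define \<tau> where "\<tau> = 4 * \<Lambda> * \<delta>"
  have \<tau>: "\<tau> > 0" using \<Lambda> \<delta> by (simp add: \<tau>_def)
  have R: "(1 + 4 * \<Lambda>) * \<delta> = \<delta> + \<tau>" by (simp add: \<tau>_def algebra_simps)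
  have sub: "ball p' (\<delta> + \<tau>) \<subseteq> ball p s" using p'(1) by (simp add: R)
  have X0: "X > 0" using X(1) \<Lambda> \<delta> by simp
  have lnX: "- ln X > 0" using X0 X(3) by simp
  have small: "H y < X" if "y \<in> ball p' (\<delta> + \<tau>)" for y
  proof -
    have p'in: "p' \<in> ball p s" using \<delta> \<tau> by (intro subsetD[OF sub]) auto
    have "\<bar>H y - H p'\<bar> \<le> \<Lambda> * norm (y - p')" using that sub p'in by (intro Lip) auto
    also have "\<dots> < X"
      unfolding X(1) R using that \<Lambda> by (intro mult_strict_left_mono) (auto simp: dist_norm norm_minus_commute)
    finally show ?thesis using p'(2) by simp
  qed
  have shift: "x + t *\<^sub>R e \<in> ball p' (\<delta> + \<tau>)" if "x \<in> ball p' \<delta>" "0 \<le> t" "t \<le> \<tau>" for x t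
    using that e dist_triangle[of p' "x + t *\<^sub>R e" x] by (simp add: dist_norm)
  have in_s: "x \<in> ball p s" if "x \<in> ball p' \<delta>" for x
    using that \<tau> by (intro subsetD[OF sub]) auto
  have H_shift: "H (x + t *\<^sub>R e) = H x + t" if "x \<in> ball p' \<delta>" "0 \<le> t" "t \<le> \<tau>" for x t
    by (rule trans[OF in_s[OF that(1)] subsetD[OF sub shift[OF that]]])
  have H_lt: "H x + t < X" if "x \<in> ball p' \<delta>" "0 \<le> t" "t \<le> \<tau>" for x t
    using small[OF shift[OF that]] H_shift[OF that] by simp
  \<comment> \<open>\<Psi> is the antiderivative of the bound \<Psi>' that tends to 0 at height 0,
    so a vertical leg below height \<open>X\<close> costs at most \<open>\<Psi> X\<close> however
    close to the boundary it begins.\<close>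
  define \<Psi> where "\<Psi> x = K / \<nu> * (- ln x) powr (- \<nu>)" for x
  define \<Psi>' where "\<Psi>' x = K / (x * (- ln x) powr (1 + \<nu>))" for x
  have \<Psi>_nonneg: "\<Psi> x \<ge> 0" for x using K \<nu> by (simp add: \<Psi>_def)
  have \<Psi>'_nonneg: "\<Psi>' x \<ge> 0" if "x > 0" for x using K that by (simp add: \<Psi>'_def)
  have \<Psi>_le: "\<Psi> x \<le> \<Psi> X" if "0 < x" "x < X" for x
    unfolding \<Psi>_def using K \<nu> lnX that by (intro mult_left_mono powr_mono2') auto
  have \<Psi>_deriv: "(\<Psi> has_real_derivative \<Psi>' x) (at x)" if "0 < x" "x < 1" for x
  proof -
    have l: "- ln x > 0" using that by simp
    have "((\<lambda>x. - ln x) has_real_derivative - (1 / x)) (at x)"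
      using that by (auto intro!: derivative_eq_intros)
    from DERIV_fun_powr[OF this l, of "- \<nu>"]
    have "((\<lambda>x. (- ln x) powr (- \<nu>)) has_real_derivative \<nu> * (- ln x) powr (- (1 + \<nu>)) / x) (at x)"
      by (simp add: algebra_simps minus_diff_commute[of \<nu> 1])
    from DERIV_cmult[OF this, of "K / \<nu>"] have "(\<Psi> has_real_derivative K / \<nu> * (\<nu> * (- ln x) powr (- (1 + \<nu>)) / x)) (at x)"
      unfolding \<Psi>_def .
    moreover have "K / \<nu> * (\<nu> * (- ln x) powr (- (1 + \<nu>)) / x) = \<Psi>' x"
      unfolding \<Psi>'_def powr_minus using \<nu> by (simp add: divide_inverse)
    ultimately show ?thesis by simp
  qed
  have \<Psi>_shift: "((\<lambda>t. \<Psi> (c + a * t)) has_real_derivative \<Psi>' (c + a * t) * a) (at t)"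
    if "0 < c + a * t" "c + a * t < 1" for a c t
    by (rule DERIV_chain2[where f = \<Psi> and g = "\<lambda>t. c + a * t", OF \<Psi>_deriv[OF that]])
      (auto intro!: derivative_eq_intros)
  have est': "norm (A *v v) \<le> norm v * \<Psi>' (H y)"
    if "y \<in> ball p' (\<delta> + \<tau>)" "0 < H y" "(F has_derivative (\<lambda>h. A *v h)) (at y)" "F y \<in> ball q r" for y A v
  proof -
    have "norm (A *v v) \<le> K * norm v / (H y * (- ln (H y)) powr (1 + \<nu>))"
      using that sub small[OF that(1)] X(2) by (intro est) auto
    then show ?thesis by (simp add: \<Psi>'_def mult.commute)
  qed
  have inD: "y \<in> D" if "y \<in> ball p' (\<delta> + \<tau>)" "0 < H y" for y using that inside sub by blast
  have z1: "z1 \<in> ball p' \<delta>" "H z1 > 0" and z2: "z2 \<in> ball p' \<delta>" "H z2 > 0"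
    using z inside in_s by blast+
  define b where "b = K * (- ln X) powr (- (1 + \<nu>))"
  have b: "b \<ge> 0" using K by (simp add: b_def)
  have osc: "osc = 2 * \<Psi> X + b" by (simp add: osc_def \<Psi>_def b_def)

  have up: "norm (F (z1 + \<tau> *\<^sub>R e) - F z1) \<le> \<Psi> (H z1 + \<tau>) - \<Psi> (H z1 + 0)"
  proof (rule bootstrap_segment[where B' = "\<lambda>t. \<Psi>' (H z1 + t)" and q = q and r = r, OF hol \<tau>])
    fix t assume t: "0 \<le> t" "t \<le> \<tau>"
    note S = shift[OF z1(1) t] and HS = H_shift[OF z1(1) t]
    show "z1 + t *\<^sub>R e \<in> D" using inD[OF S] HS z1 t by simp
    show "((\<lambda>t. \<Psi> (H z1 + t)) has_real_derivative \<Psi>' (H z1 + t)) (at t)"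
      using \<Psi>_shift[of "H z1" 1 t] H_lt[OF z1(1) t] z1(2) t X(3) by simp
    show "0 \<le> \<Psi>' (H z1 + t)" using z1 t by (intro \<Psi>'_nonneg) auto
    show "norm (A *v e) \<le> \<Psi>' (H z1 + t)"
      if "(F has_derivative (*v) A) (at (z1 + t *\<^sub>R e))" "F (z1 + t *\<^sub>R e) \<in> ball q r" for A
      using est'[OF S _ that, of e] HS z1 t e by simp
  next
    have "\<Psi> (H z1 + \<tau>) \<le> \<Psi> X" using H_lt[OF z1(1), of \<tau>] z1 \<tau> by (intro \<Psi>_le) auto
    then show "norm (F z1 - q) + (\<Psi> (H z1 + \<tau>) - \<Psi> (H z1 + 0)) < r"
      using start \<Psi>_nonneg[of "H z1"] \<Psi>_nonneg[of X] b unfolding osc by simp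
  qed
  also have "\<dots> \<le> \<Psi> X"
  proof -
    have "\<Psi> (H z1 + \<tau>) \<le> \<Psi> X" using H_lt[OF z1(1), of \<tau>] z1 \<tau> by (intro \<Psi>_le) auto
    then show ?thesis using \<Psi>_nonneg[of "H z1"] by simp
  qed
  finally have up: "norm (F (z1 + \<tau> *\<^sub>R e) - F z1) \<le> \<Psi> X" .

  have "norm (F (z1 + \<tau> *\<^sub>R e + 1 *\<^sub>R (z2 - z1)) - F (z1 + \<tau> *\<^sub>R e)) \<le> b * 1 - b * 0"
  proof (rule bootstrap_segment[where B' = "\<lambda>t. b" and q = q and r = r, OF hol])
    fix t :: real assume t: "0 \<le> t" "t \<le> 1"
    define x where "x = z1 + t *\<^sub>R (z2 - z1)"
    have eq: "z1 + \<tau> *\<^sub>R e + t *\<^sub>R (z2 - z1) = x + \<tau> *\<^sub>R e" by (simp add: x_def)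
    have "x = (1 - t) *\<^sub>R z1 + t *\<^sub>R z2" by (simp add: x_def algebra_simps)
    then have x: "x \<in> ball p' \<delta>" using convexD_alt[OF convex_ball z1(1) z2(1)] t by simp
    have near: "norm (y - y') < 2 * \<delta>" if "y \<in> ball p' \<delta>" "y' \<in> ball p' \<delta>" for y y'
      using that norm_triangle_ineq4[of "y - p'" "y' - p'"] by (simp add: dist_norm norm_minus_commute)
    note S = shift[OF x, of \<tau>] and HS = H_shift[OF x, of \<tau>]
    have "\<bar>H x - H z1\<bar> \<le> \<Lambda> * norm (x - z1)"
      by (intro Lip in_s x z1)
    also have "\<dots> \<le> \<Lambda> * (2 * \<delta>)" using near[OF x z1(1)] \<Lambda> by (intro mult_left_mono) auto
    finally have Hx1: "\<bar>H x - H z1\<bar> \<le> \<Lambda> * (2 * \<delta>)" .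
    \<comment> \<open>The reason for \<tau> = 4 \<Lambda> \<delta>: \<open>H\<close> varies by at
      most 2 \<Lambda> \<delta> between the points involved, so the crossing runs at a height no
      smaller than its length. The factor 1 / h in \<Psi>' then cancels and leaves
      \<open>b\<close>.\<close>
    have Hx: "2 * \<delta> \<le> H x + \<tau>"
    proof -
      have "\<delta> \<le> \<Lambda> * \<delta>" using mult_right_mono[OF \<Lambda>, of \<delta>] \<delta> by simp
      then show ?thesis using Hx1 z1(2) unfolding \<tau>_def by linarith
    qed
    then have HD: "H (x + \<tau> *\<^sub>R e) > 0" using HS \<tau> \<delta> by simp
    show "z1 + \<tau> *\<^sub>R e + t *\<^sub>R (z2 - z1) \<in> D"
      unfolding eq using inD[OF S HD] \<tau> by simp
    show "((\<lambda>t. b * t) has_real_derivative b) (at t)" by (auto intro!: derivative_eq_intros)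
    show "norm (A *v (z2 - z1)) \<le> b"
      if "(F has_derivative (*v) A) (at (z1 + \<tau> *\<^sub>R e + t *\<^sub>R (z2 - z1)))"
         "F (z1 + \<tau> *\<^sub>R e + t *\<^sub>R (z2 - z1)) \<in> ball q r" for A
    proof -
      define h where "h = H x + \<tau>"
      have h: "0 < h" "h < X" "2 * \<delta> \<le> h" using Hx \<delta> H_lt[OF x, of \<tau>] \<tau> by (auto simp: h_def)
      have "norm (A *v (z2 - z1)) \<le> norm (z2 - z1) * \<Psi>' h"
        using est'[OF S HD] that HS \<tau> unfolding eq h_def by simp
      also have "\<dots> \<le> h * \<Psi>' h"
        using near[OF z2(1) z1(1)] h \<Psi>'_nonneg[of h] by (intro mult_right_mono) auto
      also have "\<dots> = K * (- ln h) powr (- (1 + \<nu>))"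
        unfolding powr_minus \<Psi>'_def using h by (simp add: divide_inverse)
      also have "\<dots> \<le> b"
        unfolding b_def using K \<nu> lnX h X0 by (intro mult_left_mono powr_mono2') auto
      finally show ?thesis .
    qed
    show "0 \<le> b" by (rule b)
  next
    show "norm (F (z1 + \<tau> *\<^sub>R e) - q) + (b * 1 - b * 0) < r"
      using norm_triangle_ineq[of "F (z1 + \<tau> *\<^sub>R e) - F z1" "F z1 - q"] up start \<Psi>_nonneg[of X]
      unfolding osc by simp
  qed simp
  then have across: "norm (F (z2 + \<tau> *\<^sub>R e) - F (z1 + \<tau> *\<^sub>R e)) \<le> b"
    by (simp add: algebra_simps)

  \<comment> \<open>The downward leg is parametrised from the top, so the comparison function is
    minus \<Psi> at the remaining height, which increases with \<open>t\<close> as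
    \<open>bootstrap_segment\<close> requires.\<close>
  have "norm (F (z2 + \<tau> *\<^sub>R e + \<tau> *\<^sub>R (- e)) - F (z2 + \<tau> *\<^sub>R e)) \<le> - \<Psi> (H z2 + \<tau> - \<tau>) - - \<Psi> (H z2 + \<tau> - 0)"
  proof (rule bootstrap_segment[where B' = "\<lambda>t. \<Psi>' (H z2 + \<tau> - t)" and q = q and r = r, OF hol \<tau>])
    fix t assume t: "0 \<le> t" "t \<le> \<tau>"
    then have t': "0 \<le> \<tau> - t" "\<tau> - t \<le> \<tau>" by auto
    have eq: "z2 + \<tau> *\<^sub>R e + t *\<^sub>R (- e) = z2 + (\<tau> - t) *\<^sub>R e" by (simp add: algebra_simps)
    note S = shift[OF z2(1) t'] and HS = H_shift[OF z2(1) t']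
    show "z2 + \<tau> *\<^sub>R e + t *\<^sub>R (- e) \<in> D" unfolding eq using inD[OF S] HS z2 t by simp
    show "((\<lambda>t. - \<Psi> (H z2 + \<tau> - t)) has_real_derivative \<Psi>' (H z2 + \<tau> - t)) (at t)"
      using DERIV_minus[OF \<Psi>_shift[of "H z2 + \<tau>" "- 1" t]] H_lt[OF z2(1) t'] z2(2) t X(3)
      by (simp add: algebra_simps)
    show "0 \<le> \<Psi>' (H z2 + \<tau> - t)" using z2 t by (intro \<Psi>'_nonneg) auto
    show "norm (A *v (- e)) \<le> \<Psi>' (H z2 + \<tau> - t)"
      if "(F has_derivative (*v) A) (at (z2 + \<tau> *\<^sub>R e + t *\<^sub>R (- e)))" "F (z2 + \<tau> *\<^sub>R e + t *\<^sub>R (- e)) \<in> ball q r" for A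
    proof -
      have Heq: "H (z2 + (\<tau> - t) *\<^sub>R e) = H z2 + \<tau> - t" using HS by simp
      have "H (z2 + (\<tau> - t) *\<^sub>R e) > 0" unfolding Heq using z2 t by simp
      from est'[OF S this that[unfolded eq], of "- e"] show ?thesis unfolding Heq by (simp add: e)
    qed
  next
    have "\<Psi> (H z2 + \<tau>) \<le> \<Psi> X" using H_lt[OF z2(1), of \<tau>] z2 \<tau> by (intro \<Psi>_le) auto
    moreover have "norm (F (z2 + \<tau> *\<^sub>R e) - q) \<le> norm (F z1 - q) + \<Psi> X + b"
      using norm_triangle_ineq[of "F (z2 + \<tau> *\<^sub>R e) - F (z1 + \<tau> *\<^sub>R e)" "F (z1 + \<tau> *\<^sub>R e) - q"]
        norm_triangle_ineq[of "F (z1 + \<tau> *\<^sub>R e) - F z1" "F z1 - q"] up across by simp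
    ultimately show "norm (F (z2 + \<tau> *\<^sub>R e) - q) + (- \<Psi> (H z2 + \<tau> - \<tau>) - - \<Psi> (H z2 + \<tau> - 0)) < r"
      using start \<Psi>_nonneg[of "H z2"] unfolding osc by simp
  qed
  moreover have "\<Psi> (H z2 + \<tau>) \<le> \<Psi> X" using H_lt[OF z2(1), of \<tau>] z2 \<tau> by (intro \<Psi>_le) auto
  ultimately have down: "norm (F z2 - F (z2 + \<tau> *\<^sub>R e)) \<le> \<Psi> X"
    using \<Psi>_nonneg[of "H z2"] by simp
  show ?thesis
    using up across down
      norm_triangle_ineq[of "F z2 - F (z2 + \<tau> *\<^sub>R e)" "F (z2 + \<tau> *\<^sub>R e) - F z1"]
      norm_triangle_ineq[of "F (z2 + \<tau> *\<^sub>R e) - F (z1 + \<tau> *\<^sub>R e)" "F (z1 + \<tau> *\<^sub>R e) - F z1"]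
    unfolding osc by simp
qed

section \<open>From small oscillation to a continuous extension\<close>

lemma log_modulus_tendsto_0:
  fixes K \<nu> :: real
  assumes "\<nu> > 0"
  shows "((\<lambda>X. 2 * (K / \<nu> * (- ln X) powr (- \<nu>)) + K * (- ln X) powr (- (1 + \<nu>))) \<longlongrightarrow> 0) (at_right 0)"
proof -
  have "filterlim (\<lambda>x :: real. - ln x) at_top (at_right 0)"
    using ln_at_0 by (simp add: filterlim_uminus_at_top)
  then have "((\<lambda>X :: real. (- ln X) powr (- \<nu>)) \<longlongrightarrow> 0) (at_right 0)"
    "((\<lambda>X :: real. (- ln X) powr (- (1 + \<nu>))) \<longlongrightarrow> 0) (at_right 0)"
    using assms by (auto intro!: tendsto_neg_powr)
  then show ?thesis by (intro tendsto_add_zero tendsto_mult_right_zero)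
qed

text \<open>The Cauchy criterion: one sequence in \<open>D\<close> produces the limit, and the
  oscillation bound transfers it to every approach within \<open>D\<close>.\<close>

lemma convergent_within_if_small_oscillation:
  fixes F :: "'a :: metric_space \<Rightarrow> 'b :: banach"
  assumes "a \<in> closure D"
    and small: "\<And>\<epsilon>. \<epsilon> > 0 \<Longrightarrow> \<exists>\<delta>>0. \<forall>x\<in>D \<inter> ball a \<delta>. \<forall>y\<in>D \<inter> ball a \<delta>. norm (F y - F x) < \<epsilon>"
  shows "\<exists>l. (F \<longlongrightarrow> l) (at a within D)"
proof -
  obtain x where x: "\<And>n. x n \<in> D" "x \<longlonglongrightarrow> a" using assms(1) unfolding closure_sequential by blast
  have ev: "\<forall>\<^sub>F n in sequentially. x n \<in> D \<inter> ball a \<delta>" if "\<delta> > 0" for \<delta>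
    using tendstoD[OF x(2) that] x(1) by (auto simp: dist_commute)
  have "Cauchy (\<lambda>n. F (x n))"
    unfolding Cauchy_iff
  proof (intro allI impI)
    fix \<epsilon> :: real assume "\<epsilon> > 0"
    then obtain \<delta> where \<delta>: "\<delta> > 0" "\<And>u v. u \<in> D \<inter> ball a \<delta> \<Longrightarrow> v \<in> D \<inter> ball a \<delta> \<Longrightarrow> norm (F v - F u) < \<epsilon>"
      using small by blast
    obtain N where "\<And>n. n \<ge> N \<Longrightarrow> x n \<in> D \<inter> ball a \<delta>"
      using ev[OF \<delta>(1)] unfolding eventually_sequentially by blast
    then show "\<exists>M. \<forall>m\<ge>M. \<forall>n\<ge>M. norm (F (x m) - F (x n)) < \<epsilon>" using \<delta>(2) by blast
  qed
  then obtain l where l: "(\<lambda>n. F (x n)) \<longlonglongrightarrow> l" using Cauchy_convergent_iff convergent_def by blast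
  have "(F \<longlongrightarrow> l) (at a within D)"
  proof (rule tendstoI)
    fix \<epsilon> :: real assume \<epsilon>: "\<epsilon> > 0"
    obtain \<delta> where \<delta>: "\<delta> > 0" "\<And>u v. u \<in> D \<inter> ball a \<delta> \<Longrightarrow> v \<in> D \<inter> ball a \<delta> \<Longrightarrow> norm (F v - F u) < \<epsilon> / 2"
      using small[of "\<epsilon> / 2"] \<epsilon> by auto
    have "\<forall>\<^sub>F n in sequentially. x n \<in> D \<inter> ball a \<delta> \<and> dist (F (x n)) l < \<epsilon> / 2"
      using \<epsilon> by (intro eventually_conj ev[OF \<delta>(1)] tendstoD[OF l]) simp
    from eventually_happens'[OF sequentially_bot this]
    obtain n where n: "x n \<in> D \<inter> ball a \<delta>" "dist (F (x n)) l < \<epsilon> / 2" by (elim exE conjE)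
    have "dist (F y) l < \<epsilon>" if "y \<in> D" "dist y a < \<delta>" for y
    proof -
      have "dist (F y) (F (x n)) < \<epsilon> / 2"
        using \<delta>(2)[OF n(1), of y] that by (simp add: dist_norm dist_commute)
      then show ?thesis using n(2) dist_triangle[of "F y" l "F (x n)"] by simp
    qed
    then show "\<forall>\<^sub>F y in at a within D. dist (F y) l < \<epsilon>"
      unfolding eventually_at using \<delta>(1) by blast
  qed
  then show ?thesis by blast
qed

text \<open>Since the target is a regular space, limits along \<open>D\<close> at the individual
  points of \<open>V\<close> already glue to a continuous map.\<close>

lemma continuous_extension_if_limits:
  fixes F :: "'a :: metric_space \<Rightarrow> 'b :: metric_space"
  assumes "continuous_on D F" "V \<subseteq> closure D" "\<And>a. a \<in> V - D \<Longrightarrow> \<exists>l. (F \<longlongrightarrow> l) (at a within D)"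
  shows "\<exists>G. continuous_on (D \<union> V) G \<and> (\<forall>z\<in>D. G z = F z)"
proof -
  have at: "atin_within euclidean a D = at a within D" for a :: 'a
    by (rule filter_eqI) (auto simp: eventually_atin_within eventually_at_topological)
  obtain G where "continuous_map (top_of_set (D \<union> V)) euclidean G" "\<And>z. z \<in> D \<Longrightarrow> G z = F z"
  proof (rule continuous_map_extension_pointwise_alt[of "euclidean :: 'b topology" D "D \<union> V" euclidean F])
    show "D \<union> V \<subseteq> euclidean closure_of D" using assms(2) closure_subset by auto
    show "\<exists>l. limitin euclidean F l (atin_within euclidean t D)" if "t \<in> D \<union> V - D" for t
      using assms(3) that unfolding at limitin_canonical_iff by blast
  qed (use assms(1) in \<open>auto intro: regular_space_euclidean\<close>)
  then show ?thesis by auto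
qed

text \<open>\<open>crossing_estimate\<close> is used at two scales: around \<open>p\<close>,
  starting from the cluster sequence, to confine \<open>F\<close> to a ball about \<open>q\<close>;
  then around each nearby frontier point, at arbitrarily small radii, to obtain a limit.\<close>

lemma continuous_extension_of_log_growth:
  fixes F :: "complex ^ 'n \<Rightarrow> complex ^ 'm" and H :: "complex ^ 'n \<Rightarrow> real"
  assumes "open D" and hol: "holomorphic_map_on F D" and p: "p \<in> frontier D" and q: "q \<in> cluster_set F D p"
    and s: "s > 0" and \<Lambda>: "\<Lambda> \<ge> 1" and e: "norm e = 1"
    and Lip: "\<And>x y. x \<in> ball p s \<Longrightarrow> y \<in> ball p s \<Longrightarrow> \<bar>H x - H y\<bar> \<le> \<Lambda> * norm (x - y)"
    and trans: "\<And>x t. x \<in> ball p s \<Longrightarrow> x + t *\<^sub>R e \<in> ball p s \<Longrightarrow> H (x + t *\<^sub>R e) = H x + t"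
    and inside: "\<And>x. x \<in> ball p s \<Longrightarrow> x \<in> D \<longleftrightarrow> H x > 0"
    and zero: "\<And>x. x \<in> ball p s \<Longrightarrow> x \<in> frontier D \<longleftrightarrow> H x = 0"
    and K: "K > 0" and \<nu>: "\<nu> > 0" and h0: "h0 > 0" and r: "r > 0"
    and est: "\<And>z A v. z \<in> ball p s \<Longrightarrow> 0 < H z \<Longrightarrow> H z < h0 \<Longrightarrow> (F has_derivative (\<lambda>h. A *v h)) (at z) \<Longrightarrow>
        F z \<in> ball q r \<Longrightarrow> norm (A *v v) \<le> K * norm v / (H z * (- ln (H z)) powr (1 + \<nu>))"
  shows "\<exists>V. openin (top_of_set (frontier D)) V \<and> p \<in> V \<and>
           (\<exists>G. continuous_on (D \<union> V) G \<and> (\<forall>z\<in>D. G z = F z))"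
proof -
  define osc where "osc X = 2 * (K / \<nu> * (- ln X) powr (- \<nu>)) + K * (- ln X) powr (- (1 + \<nu>))" for X
  \<comment> \<open>The cap \<open>min h0 (1 / 2)\<close> keeps heights in the range of
    \<open>est\<close> and keeps ln X negative.\<close>
  have osc0: "\<exists>X0>0. X0 \<le> min h0 (1 / 2) \<and> (\<forall>X. 0 < X \<and> X < X0 \<longrightarrow> osc X < \<epsilon>)" if "\<epsilon> > 0" for \<epsilon>
  proof -
    have "\<forall>\<^sub>F X in at_right 0. osc X < \<epsilon>"
      using order_tendstoD(2)[OF log_modulus_tendsto_0[OF \<nu>, of K] that] by (simp add: osc_def)
    then obtain b where "b > 0" "\<And>X. 0 < X \<Longrightarrow> X < b \<Longrightarrow> osc X < \<epsilon>"
      unfolding eventually_at_right_field by auto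
    then show ?thesis using h0 by (intro exI[of _ "min b (min h0 (1 / 2))"]) auto
  qed
  define N where "N = 1 + 4 * \<Lambda>"
  have N: "N \<ge> 1" using \<Lambda> by (simp add: N_def)
  have cross: "norm (F z2 - F z1) < \<epsilon>"
    if "\<delta> > 0" "ball p' (N * \<delta>) \<subseteq> ball p s" "p' \<in> frontier D" "\<Lambda> * (N * \<delta>) < X0" "X0 \<le> min h0 (1 / 2)"
      "\<And>X. 0 < X \<Longrightarrow> X < X0 \<Longrightarrow> osc X < \<epsilon>"
      "z1 \<in> D \<inter> ball p' \<delta>" "z2 \<in> D \<inter> ball p' \<delta>" "norm (F z1 - q) + \<epsilon> \<le> r" for \<epsilon> \<delta> p' X0 z1 z2
  proof -
    define X where "X = \<Lambda> * (N * \<delta>)"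
    have "X > 0" using that(1) \<Lambda> N by (simp add: X_def)
    then have lt: "osc X < \<epsilon>" using that(4,6) by (simp add: X_def)
    have "p' \<in> ball p s" using that(1) N by (intro subsetD[OF that(2)]) auto
    then have "H p' = 0" using zero that(3) by blast
    have "X \<le> h0" "X < 1" using that(4,5) by (auto simp: X_def)
    have "norm (F z2 - F z1) \<le> osc X"
      unfolding osc_def
    proof (rule crossing_estimate[OF hol \<Lambda> e Lip trans inside K \<nu> est that(1) _ _ X_def[unfolded N_def] _ _ that(7,8)])
      show "norm (F z1 - q) + (2 * (K / \<nu> * (- ln X) powr - \<nu>) + K * (- ln X) powr - (1 + \<nu>)) < r"
        using lt that(9) unfolding osc_def by linarith
    qed (use that(2) \<open>H p' = 0\<close> \<open>X \<le> h0\<close> \<open>X < 1\<close> in \<open>simp_all add: N_def\<close>)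
    then show ?thesis using lt by simp
  qed
  obtain X0 where X0: "X0 > 0" "X0 \<le> min h0 (1 / 2)" "\<And>X. 0 < X \<Longrightarrow> X < X0 \<Longrightarrow> osc X < r / 4"
    using osc0[of "r / 4"] r by auto
  define \<delta>1 where "\<delta>1 = min (s / N) (X0 / (2 * \<Lambda> * N))"
  have \<delta>1: "\<delta>1 > 0" "N * \<delta>1 \<le> s" "\<Lambda> * (N * \<delta>1) < X0"
  proof -
    show "\<delta>1 > 0" using s N \<Lambda> X0 by (simp add: \<delta>1_def)
    show "N * \<delta>1 \<le> s" using N by (simp add: \<delta>1_def min_def field_simps)
    have "\<Lambda> * (N * \<delta>1) \<le> \<Lambda> * (N * (X0 / (2 * \<Lambda> * N)))"
      using N \<Lambda> by (intro mult_left_mono) (auto simp: \<delta>1_def)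
    also have "\<dots> = X0 / 2" using N \<Lambda> by simp
    finally show "\<Lambda> * (N * \<delta>1) < X0" using X0 by simp
  qed
  \<comment> \<open>A term of the cluster sequence starts within r / 4 of \<open>q\<close>, and
    crossing to \<open>z\<close> costs less than another r / 4.\<close>
  have near_q: "norm (F z - q) < r / 2" if z: "z \<in> D \<inter> ball p \<delta>1" for z
  proof -
    obtain x where x: "\<And>n. x n \<in> D" "x \<longlonglongrightarrow> p" "(\<lambda>n. F (x n)) \<longlonglongrightarrow> q"
      using q unfolding cluster_set_def by blast
    have "\<forall>\<^sub>F n in sequentially. dist (x n) p < \<delta>1 \<and> dist (F (x n)) q < r / 4"
      using r by (intro eventually_conj tendstoD[OF x(2) \<delta>1(1)] tendstoD[OF x(3)]) simp
    from eventually_happens'[OF sequentially_bot this]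
    obtain n where n: "dist (x n) p < \<delta>1" "dist (F (x n)) q < r / 4" by (elim exE conjE)
    have "ball p (N * \<delta>1) \<subseteq> ball p s" using \<delta>1(2) by (rule subset_ball)
    moreover have "x n \<in> D \<inter> ball p \<delta>1" using n(1) x(1) by (simp add: dist_commute)
    moreover have "norm (F (x n) - q) + r / 4 \<le> r" using n(2) r by (simp add: dist_norm)
    ultimately have "norm (F z - F (x n)) < r / 4"
      by (intro cross[OF \<delta>1(1) _ p \<delta>1(3) X0(2) _ _ z] X0(3))
    then show ?thesis using n(2) norm_triangle_ineq[of "F z - F (x n)" "F (x n) - q"] by (simp add: dist_norm)
  qed
  define V where "V = frontier D \<inter> ball p \<delta>1"
  have "\<exists>G. continuous_on (D \<union> V) G \<and> (\<forall>z\<in>D. G z = F z)"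
  proof (rule continuous_extension_if_limits)
    show "continuous_on D F" using hol by (rule holomorphic_map_on_imp_continuous_on)
    show "V \<subseteq> closure D" by (auto simp: V_def frontier_def)
    fix p' assume "p' \<in> V - D"
    then have p': "p' \<in> frontier D" "p' \<in> ball p \<delta>1" by (auto simp: V_def)
    show "\<exists>l. (F \<longlongrightarrow> l) (at p' within D)"
    proof (rule convergent_within_if_small_oscillation)
      show "p' \<in> closure D" using p'(1) by (simp add: frontier_def)
      fix \<epsilon> :: real assume \<epsilon>: "\<epsilon> > 0"
      \<comment> \<open>The cap r / 2 together with \<open>near_q\<close> supplies the margin that
        \<open>cross\<close> asks of its starting point.\<close>
      obtain X1 where X1: "X1 > 0" "X1 \<le> min h0 (1 / 2)" "\<And>X. 0 < X \<Longrightarrow> X < X1 \<Longrightarrow> osc X < min \<epsilon> (r / 2)"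
        using osc0[of "min \<epsilon> (r / 2)"] r \<epsilon> by auto
      define \<delta> where "\<delta> = min ((\<delta>1 - dist p p') / N) (X1 / (2 * \<Lambda> * N))"
      have \<delta>: "\<delta> > 0" "N * \<delta> \<le> \<delta>1 - dist p p'" "\<Lambda> * (N * \<delta>) < X1"
      proof -
        show "\<delta> > 0" using p'(2) N \<Lambda> X1 by (simp add: \<delta>_def)
        show "N * \<delta> \<le> \<delta>1 - dist p p'" using N by (simp add: \<delta>_def min_def field_simps)
        have "\<Lambda> * (N * \<delta>) \<le> \<Lambda> * (N * (X1 / (2 * \<Lambda> * N)))"
          using N \<Lambda> by (intro mult_left_mono) (auto simp: \<delta>_def)
        also have "\<dots> = X1 / 2" using N \<Lambda> by simp
        finally show "\<Lambda> * (N * \<delta>) < X1" using X1 by simp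
      qed
      have "ball p' (N * \<delta>) \<subseteq> ball p \<delta>1"
      proof
        fix x assume "x \<in> ball p' (N * \<delta>)"
        then show "x \<in> ball p \<delta>1" using \<delta>(2) dist_triangle[of p x p'] by simp
      qed
      moreover have "1 * \<delta> \<le> N * \<delta>" "1 * \<delta>1 \<le> N * \<delta>1" using N \<delta> \<delta>1 by (intro mult_right_mono; simp)+
      ultimately have balls: "ball p' \<delta> \<subseteq> ball p \<delta>1" "ball p' (N * \<delta>) \<subseteq> ball p s"
        using \<delta>1(2) by (auto simp: subset_iff)
      have "norm (F y - F x) < min \<epsilon> (r / 2)" if x: "x \<in> D \<inter> ball p' \<delta>" and y: "y \<in> D \<inter> ball p' \<delta>" for x y
      proof -
        have "x \<in> D \<inter> ball p \<delta>1" using x balls by blast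
        from near_q[OF this] have "norm (F x - q) + min \<epsilon> (r / 2) \<le> r" by simp
        then show ?thesis by (intro cross[OF \<delta>(1) balls(2) p'(1) \<delta>(3) X1(2) _ x y] X1(3))
      qed
      then show "\<exists>\<delta>>0. \<forall>x\<in>D \<inter> ball p' \<delta>. \<forall>y\<in>D \<inter> ball p' \<delta>. norm (F y - F x) < \<epsilon>"
        using \<delta>(1) by (intro exI[of _ \<delta>]) auto
    qed
  qed
  moreover have "p \<in> V" using p \<delta>1(1) by (simp add: V_def)
  moreover have "openin (top_of_set (frontier D)) V" unfolding V_def by (intro openin_open_Int open_ball)
  ultimately show ?thesis by blast
qed

section \<open>Combination of the decay and derivative estimates through the height
  \<open>H\<close>\<close>

theorem theorem1p7:
  fixes D \<Omega> U \<O> :: "(complex ^ 'n) set"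
    and F :: "complex ^ 'n \<Rightarrow> complex ^ 'n"
    and p q :: "complex ^ 'n"
    and \<rho> :: "complex ^ 'n \<Rightarrow> real"
  assumes "CARD('n) \<ge> 2"
    and "open D" and "connected D" and "D \<noteq> {}"
    and "open \<Omega>" and "connected \<Omega>" and "\<Omega> \<noteq> {}" and "bounded \<Omega>"
    and "holomorphic_map_on F D" and "F ` D \<subseteq> \<Omega>"
    and "proper_map (top_of_set D) (top_of_set \<Omega>) F"
    and "p \<in> frontier D" and "q \<in> cluster_set F D p"
    and "continuous_plurisubharmonic_on D \<rho>" and "\<forall>z\<in>D. \<rho> z < 0"
    and "open U" and "p \<in> U" and "C1_Dini_boundary D U"
    and "\<forall>z\<in>U \<inter> D. \<rho> z \<ge> - infdist z (- D)"
    and "open \<O>" and "q \<in> \<O>"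
    and "C2_submanifold (frontier \<Omega> \<inter> \<O>) \<O>"
    and "log_type_convex (\<O> \<inter> \<Omega>)"
  shows "\<exists>V. openin (top_of_set (frontier D)) V \<and> p \<in> V \<and>
           (\<exists>G :: complex ^ 'n \<Rightarrow> complex ^ 'n.
              continuous_on (D \<union> V) G \<and> (\<forall>z\<in>D. G z = F z))"
proof -
  note hol = assms(9)
  define G where "G = \<O> \<inter> \<Omega>"
  have G: "open G" "convex G" "bounded G" "G \<noteq> {}"
    using assms(23) unfolding log_type_convex_def G_def by - ((elim conjE, assumption)+)
  have "G \<subseteq> \<Omega>" by (simp add: G_def)
  have neg: "\<rho> z < 0" if "z \<in> D" for z using assms(15) that by blast
  have "\<forall>K. compact K \<and> K \<subseteq> \<Omega> \<longrightarrow> compact {z \<in> D. F z \<in> K}"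
    using proper_map_iff_compact_preimage[OF holomorphic_map_on_imp_continuous_on[OF hol] assms(10,5)] assms(11) by blast
  then have proper: "compact {z \<in> D. F z \<in> K}" if "compact K" "K \<subseteq> \<Omega>" for K using that by blast
  have "\<exists>c>0. \<exists>k>0. \<forall>z\<in>D. F z \<in> G \<longrightarrow> \<rho> z \<le> - c * infdist (F z) (- G) powr k"
    by (rule psh_power_decay[OF hol assms(2,14) neg proper G \<open>G \<subseteq> \<Omega>\<close>])
  then obtain c k where c: "c > 0" and k: "k > 0" and
    decay: "\<And>z. z \<in> D \<Longrightarrow> F z \<in> G \<Longrightarrow> \<rho> z \<le> - c * infdist (F z) (- G) powr k"
    by (elim exE conjE) (rule that; blast)
  obtain r0 where r0: "r0 > 0" "ball q r0 \<subseteq> \<O>"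
    using assms(20,21) open_contains_ball by blast
  obtain C \<nu> where C: "C > 0" and \<nu>: "\<nu> > 0" and
    deriv0: "\<forall>z r A v. r > 0 \<longrightarrow> ball z r \<subseteq> D \<longrightarrow> (F has_derivative (\<lambda>h. A *v h)) (at z) \<longrightarrow>
      F z \<in> ball q (r0 / 2) \<longrightarrow> infdist (F z) (- G) \<noteq> 1 \<longrightarrow>
      norm (A *v v) \<le> C * norm v / (r * \<bar>ln (infdist (F z) (- G))\<bar> powr (1 + \<nu>))"
    using log_type_deriv_estimate[OF hol assms(10,8) r0 assms(23), folded G_def] by (elim exE conjE) (rule that)
  note deriv = deriv0[rule_format]
  obtain s \<Lambda> e H where s: "s > 0" and \<Lambda>: "\<Lambda> \<ge> 1" and U: "ball p s \<subseteq> U" and e: "norm e = 1" and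
    Lip: "\<And>x y. x \<in> ball p s \<Longrightarrow> y \<in> ball p s \<Longrightarrow> \<bar>H x - H y\<bar> \<le> \<Lambda> * norm (x - y)" and
    trans: "\<And>x t. x \<in> ball p s \<Longrightarrow> x + t *\<^sub>R e \<in> ball p s \<Longrightarrow> H (x + t *\<^sub>R e) = H x + t" and
    inside: "\<And>x. x \<in> ball p s \<Longrightarrow> x \<in> D \<longleftrightarrow> H x > 0" and
    zero: "\<And>x. x \<in> ball p s \<Longrightarrow> x \<in> frontier D \<longleftrightarrow> H x = (0::real)"
    by (rule C1_Dini_boundary_local_defining_function[OF assms(2,12,17,18)]) (rule that)
  have Hp: "H p = 0" using zero[of p] s assms(12) by simp
  \<comment> \<open>From a point of \<open>ball p s2\<close>, a vertical descent by |H z| <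
    \<Lambda> s2 and a step shorter than H z / \<Lambda> < s2 both end in \<open>ball p s\<close>,
    where \<open>H\<close> describes \<open>D\<close>.\<close>
  define s2 where "s2 = s / (2 + \<Lambda>)"
  have s2: "s2 > 0" "s2 * (2 + \<Lambda>) = s" using s \<Lambda> by (auto simp: s2_def)
  have \<Lambda>s2: "s2 + \<Lambda> * s2 < s" "s2 + s2 < s"
    using s2 \<Lambda> mult_right_mono[OF \<Lambda>, of s2] by (auto simp: algebra_simps)
  have sub: "ball p s2 \<subseteq> ball p s" using \<Lambda>s2(2) s2(1) by (intro subset_ball) linarith
  have H_le: "\<bar>H z\<bar> < \<Lambda> * s2" if "z \<in> ball p s2" for z
  proof -
    have "\<bar>H z - H p\<bar> \<le> \<Lambda> * norm (z - p)" using that sub s by (intro Lip) auto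
    also have "\<dots> < \<Lambda> * s2"
      using that \<Lambda> by (intro mult_strict_left_mono) (auto simp: dist_norm norm_minus_commute)
    finally show ?thesis by (simp add: Hp)
  qed
  have polydisc: "ball z (H z / \<Lambda>) \<subseteq> D" if z: "z \<in> ball p s2" for z
  proof
    fix y assume y: "y \<in> ball z (H z / \<Lambda>)"
    then have yz: "norm (z - y) * \<Lambda> < H z" using \<Lambda> by (simp add: dist_norm pos_less_divide_eq)
    have "H z / \<Lambda> < s2" using H_le[OF z] \<Lambda> by (simp add: pos_divide_less_eq mult.commute)
    then have ys: "y \<in> ball p s" using y z \<Lambda>s2 dist_triangle[of p y z] by simp
    have "H z - H y \<le> \<Lambda> * norm (z - y)" using Lip[of z y] ys z sub by auto
    then have "H y > 0" using yz by (simp add: mult.commute)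
    then show "y \<in> D" using inside ys by blast
  qed
  \<comment> \<open>The point vertically below \<open>z\<close> at depth \<open>H z\<close> has
    height 0. Together with \<open>polydisc\<close>, the boundary distance thus lies between H z /
    \<Lambda> and H z.\<close>
  have dist_le: "infdist z (- D) \<le> H z" if z: "z \<in> ball p s2" "H z > 0" for z
  proof -
    define y where "y = z + (- H z) *\<^sub>R e"
    have yz: "dist z y = H z" using z(2) e by (simp add: y_def dist_norm)
    then have ys: "y \<in> ball p s" using z H_le[OF z(1)] \<Lambda>s2 dist_triangle[of p y z] by simp
    then have "H y = 0" using trans[of z "- H z"] z sub unfolding y_def by auto
    then have "y \<notin> D" using inside[OF ys] by simp
    then show ?thesis using infdist_le[of y "- D" z] yz by simp
  qed
  \<comment> \<open>Below c^2 one has ln (H z) \<le> 2 ln c, so the additive constant ln c is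
    absorbed at the price of replacing k by 2 k; the entry 1/2 makes ln (H z) negative.\<close>
  define h0 where "h0 = min (1 / 2) (c\<^sup>2)"
  have h0: "h0 > 0" using c by (simp add: h0_def)
  \<comment> \<open>\<Lambda> comes from the radius H z / \<Lambda> of the ball on which
    \<open>deriv\<close> is applied, and (2 k)^(1+\<nu>) from the comparison of ln d with ln (H
    z).\<close>
  define K where "K = C * \<Lambda> * (2 * k) powr (1 + \<nu>)"
  have K: "K > 0" using C \<Lambda> k by (simp add: K_def)
  have est: "norm (A *v v) \<le> K * norm v / (H z * (- ln (H z)) powr (1 + \<nu>))"
    if z: "z \<in> ball p s2" "0 < H z" "H z < h0" and A: "(F has_derivative (\<lambda>h. A *v h)) (at z)"
      and Fz: "F z \<in> ball q (r0 / 2)" for z A v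
  proof -
    have zs: "z \<in> ball p s" using z sub by blast
    then have "z \<in> D" using inside z by blast
    then have FG: "F z \<in> G" using Fz r0 assms(10) by (auto simp: G_def)
    define d where "d = infdist (F z) (- G)"
    have "closed (- G)" "- G \<noteq> {}"
      using G(1,3) not_bounded_UNIV[where 'a = "complex ^ 'n"] by (auto, metis double_compl Compl_empty_eq)
    then have d: "d > 0" unfolding d_def using FG by (metis ComplD infdist_pos_not_in_closed)
    have "c * d powr k \<le> - \<rho> z" using decay[OF \<open>z \<in> D\<close> FG] by (simp add: d_def)
    also have "\<dots> \<le> infdist z (- D)" using assms(19) \<open>z \<in> D\<close> zs U by (smt (verit) IntI subsetD)
    also have "\<dots> \<le> H z" using dist_le z by blast
    finally have "ln (c * d powr k) \<le> ln (H z)" using c d by (intro ln_mono) auto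
    then have 1: "ln c + k * ln d \<le> ln (H z)" using c d by (simp add: ln_mult ln_powr)
    have "H z < 1" using z(3) by (simp add: h0_def)
    then have lnH: "ln (H z) < 0" using z by simp
    have "ln (H z) \<le> ln (c\<^sup>2)" using z c by (intro ln_mono) (auto simp: h0_def)
    then have "ln (H z) \<le> 2 * ln c" using c by (simp add: ln_realpow)
    then have "2 * k * ln d \<le> ln (H z)" using 1 by simp
    then have lnd: "- ln (H z) / (2 * k) \<le> - ln d" using k by (simp add: field_simps)
    moreover have pos: "- ln (H z) / (2 * k) > 0" using lnH k by (intro divide_pos_pos) auto
    \<comment> \<open>This also excludes d = 1, where log-type convexity gives no condition.\<close>
    ultimately have "ln d < 0" by linarith
    then have "d \<noteq> 1" by auto
    then have "norm (A *v v) \<le> C * norm v / (H z / \<Lambda> * \<bar>ln d\<bar> powr (1 + \<nu>))"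
      using deriv[OF _ polydisc[OF z(1)] A Fz, of v] z \<Lambda> by (simp add: d_def)
    also have "\<dots> \<le> C * norm v / (H z / \<Lambda> * (- ln (H z) / (2 * k)) powr (1 + \<nu>))"
      using C z \<Lambda> lnd pos \<nu> \<open>ln d < 0\<close>
      by (intro divide_left_mono mult_left_mono powr_mono2 mult_pos_pos) auto
    also have "(- ln (H z) / (2 * k)) powr (1 + \<nu>) = (- ln (H z)) powr (1 + \<nu>) / (2 * k) powr (1 + \<nu>)"
      by (rule powr_divide)
    also have "C * norm v / (H z / \<Lambda> * ((- ln (H z)) powr (1 + \<nu>) / (2 * k) powr (1 + \<nu>)))
        = K * norm v / (H z * (- ln (H z)) powr (1 + \<nu>))"
      by (simp add: K_def mult.commute mult.left_commute)
    finally show ?thesis .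
  qed
  show ?thesis
  proof (rule continuous_extension_of_log_growth[where r = "r0 / 2", OF assms(2) hol assms(12,13) s2(1) \<Lambda> e _ _ _ _ K \<nu> h0 _ est])
    show "\<bar>H x - H y\<bar> \<le> \<Lambda> * norm (x - y)" if "x \<in> ball p s2" "y \<in> ball p s2" for x y
      using that sub by (intro Lip) blast+
    show "H (x + t *\<^sub>R e) = H x + t" if "x \<in> ball p s2" "x + t *\<^sub>R e \<in> ball p s2" for x t
      by (rule trans[OF subsetD[OF sub that(1)] subsetD[OF sub that(2)]])
    show "x \<in> D \<longleftrightarrow> H x > 0" if "x \<in> ball p s2" for x
      by (rule inside[OF subsetD[OF sub that]])
    show "x \<in> frontier D \<longleftrightarrow> H x = 0" if "x \<in> ball p s2" for x
      by (rule zero[OF subsetD[OF sub that]])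
  qed (use r0 in auto)
qed

end
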